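(* Fix $\epsilon>0$ and integers $m,k$ with $1\le k\le m/2$. Let $G\le S_m$ be $k$-homogeneous, i.e. $G$ acts transitively on the set $\binom{[m]}{k}$ of $k$-element subsets of $[m]=\{1,\dots,m\}$. Then $$\left|B\left(H;G,\binom{[m]}{k}\right)\right|\ll H^{mk+1+\epsilon}.$$
   Context: The height of $f=\sum_i a_ix^i\in\mathbb{Z}[x]$ is $H(f)=\max_i|a_i|$. For $n\in\mathbb{N}$ and real $H\ge 1$, $B_n(H)=\{f\in\mathbb{Z}[x]: f\text{ monic},\ \deg f=n,\ H(f)\le H\}$. For separable $f$, $\Omega_f=\{\alpha\in\mathbb{C}:f(\alpha)=0\}$ and $G_f=\mathrm{Gal}(\mathbb{Q}(\Omega_f)/\mathbb{Q})$, which acts naturally (faithfully) on $\Omega_f$. A permutation group $(G,\Omega)$ is a finite group $G$ with a faithful action on a finite set $\Omega$; an isomorphism $(G_1,\Omega_1)\cong(G_2,\Omega_2)$ is a pair $(\varphi,\varphi^* )$ of a group isomorphism $\varphi:G_1\to G_2$ and a bijection $\varphi^*:\Omega_1\to\Omega_2$ with $\varphi(\sigma)(\varphi^*(\omega))=\varphi^*(\sigma(\omega))$ for all $\sigma\in G_1,\omega\in\Omega_1$. Set $B(H;G,\Omega)=\{f\in B_{|\Omega|}(H): f\text{ separable},\ (G_f,\Omega_f)\cong(G,\Omega)\}$. $S_m$ acts on $\binom{[m]}{k}$ by $\sigma(A)=\{\sigma(a):a\in A\}$. The notation $X\ll Y$ means that $X\le CY$ for all $H\ge1$, with $C>0$ independent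 of $H$ (it may depend on all the other fixed data). *)

theory Defs
  imports
    "HOL-Algebra.Algebraic_Closure_Type"
    "HOL-Algebra.Generated_Fields"
    "HOL-Algebra.QuotRing"
    "HOL-Algebra.Group_Action"
    "HOL-Algebra.Sym_Groups"
    "HOL-Library.Ramsey"
    "HOL-Computational_Algebra.Computational_Algebra"
    Complex_Main
begin

section \<open>Integer polynomials of bounded height\<close>

definition height :: "int poly \<Rightarrow> int" where
  "height f = (MAX i\<in>{..Polynomial.degree f}. \<bar>poly.coeff f i\<bar>)"

definition monic_polys :: "nat \<Rightarrow> real \<Rightarrow> int poly set" where
  "monic_polys n H =
     {f. Polynomial.lead_coeff f = 1 \<and> Polynomial.degree f = n \<and> real_of_int (height f) \<le> H}"

definition complex_roots :: "int poly \<Rightarrow> complex set" where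
  "complex_roots f = {\<alpha>. poly (map_poly of_int f) \<alpha> = 0}"

definition separable :: "int poly \<Rightarrow> bool" where
  "separable f \<longleftrightarrow> rsquarefree (map_poly of_int f :: complex poly)"


section \<open>Galois groups over the rationals\<close>

text \<open>Number fields are subfields of the complex numbers, the latter viewed as a HOL-Algebra ring.\<close>

definition rat_adjoin :: "complex set \<Rightarrow> complex ring" where
  "rat_adjoin S =
     (ring_of_type_algebra :: complex ring)
       \<lparr>carrier := generate_field (ring_of_type_algebra :: complex ring) (\<rat> \<union> S)\<rparr>"

text \<open>As in \<open>BijGroup\<close>, automorphisms of \<open>L\<close> are extensional functions, so that each
  automorphism is represented by exactly one function on the complex numbers.\<close>

definition Gal :: "complex ring \<Rightarrow> (complex \<Rightarrow> complex) monoid" where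
  "Gal L = BijGroup (carrier L)
     \<lparr>carrier := {\<sigma> \<in> Bij (carrier L). \<sigma> \<in> ring_iso L L \<and> (\<forall>q\<in>\<rat>. \<sigma> q = q)}\<rparr>"

definition galois_group :: "int poly \<Rightarrow> (complex \<Rightarrow> complex) monoid" where
  "galois_group f = Gal (rat_adjoin (complex_roots f))"

definition root_action :: "int poly \<Rightarrow> (complex \<Rightarrow> complex) \<Rightarrow> complex \<Rightarrow> complex" where
  "root_action f \<sigma> = (\<lambda>\<alpha>\<in>complex_roots f. \<sigma> \<alpha>)"


section \<open>Permutation groups\<close>

text \<open>A permutation group is given by a group, a set and an action in the sense of
  \<open>group_action\<close>.\<close>

definition perm_group_iso ::
  "('a, 'c) monoid_scheme \<Rightarrow> 'b set \<Rightarrow> ('a \<Rightarrow> 'b \<Rightarrow> 'b) \<Rightarrow>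
   ('d, 'f) monoid_scheme \<Rightarrow> 'e set \<Rightarrow> ('d \<Rightarrow> 'e \<Rightarrow> 'e) \<Rightarrow> bool" where
  "perm_group_iso G\<^sub>1 \<Omega>\<^sub>1 act\<^sub>1 G\<^sub>2 \<Omega>\<^sub>2 act\<^sub>2 \<longleftrightarrow>
     (\<exists>\<phi> \<psi>. \<phi> \<in> iso G\<^sub>1 G\<^sub>2 \<and> bij_betw \<psi> \<Omega>\<^sub>1 \<Omega>\<^sub>2 \<and>
        (\<forall>\<sigma>\<in>carrier G\<^sub>1. \<forall>\<omega>\<in>\<Omega>\<^sub>1. act\<^sub>2 (\<phi> \<sigma>) (\<psi> \<omega>) = \<psi> (act\<^sub>1 \<sigma> \<omega>)))"

definition galois_polys ::
  "real \<Rightarrow> ('a, 'c) monoid_scheme \<Rightarrow> 'b set \<Rightarrow> ('a \<Rightarrow> 'b \<Rightarrow> 'b) \<Rightarrow> int poly set" where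
  "galois_polys H G \<Omega> act =
     {f \<in> monic_polys (card \<Omega>) H. separable f \<and>
        perm_group_iso (galois_group f) (complex_roots f) (root_action f) G \<Omega> act}"

abbreviation perm_subgroup :: "nat \<Rightarrow> (nat \<Rightarrow> nat) set \<Rightarrow> (nat \<Rightarrow> nat) monoid" where
  "perm_subgroup m G \<equiv> sym_group m \<lparr>carrier := G\<rparr>"

definition subset_action :: "nat \<Rightarrow> nat \<Rightarrow> (nat \<Rightarrow> nat) \<Rightarrow> nat set \<Rightarrow> nat set" where
  "subset_action m k \<sigma> = (\<lambda>A\<in>nsets {1..m} k. \<sigma> ` A)"

definition homogeneous :: "nat \<Rightarrow> nat \<Rightarrow> (nat \<Rightarrow> nat) set \<Rightarrow> bool" where
  "homogeneous m k G \<longleftrightarrow>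
     transitive_action (perm_subgroup m G) (nsets {1..m} k) (subset_action m k)"


section \<open>Sanity checks\<close>

lemma finite_monic_polys: "finite (monic_polys n H)"
proof (rule finite_subset)
  let ?L = "{xs :: int list. set xs \<subseteq> {-\<lfloor>H\<rfloor>..\<lfloor>H\<rfloor>} \<and> length xs = Suc n}"
  show "monic_polys n H \<subseteq> Poly ` ?L"
  proof
    fix f assume f: "f \<in> monic_polys n H"
    have c: "\<bar>poly.coeff f i\<bar> \<le> \<lfloor>H\<rfloor>" if "i \<le> n" for i
    proof -
      have "\<bar>poly.coeff f i\<bar> \<le> height f"
        unfolding height_def using f that by (intro Max_ge) (auto simp: monic_polys_def)
      also have "\<dots> \<le> \<lfloor>H\<rfloor>" using f by (simp add: monic_polys_def le_floor_iff)
      finally show ?thesis .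
    qed
    let ?xs = "map (poly.coeff f) [0..<Suc n]"
    have "?xs \<in> ?L" using c by (auto simp: abs_le_iff minus_le_iff simp del: upt_Suc)
    moreover have "f = Poly ?xs"
    proof (rule poly_eqI)
      fix i show "poly.coeff f i = poly.coeff (Poly ?xs) i"
        using f by (cases "i \<le> n")
          (auto simp: nth_default_def monic_polys_def coeff_eq_0 simp del: upt_Suc)
    qed
    ultimately show "f \<in> Poly ` ?L" by blast
  qed
  show "finite (Poly ` ?L)" by (intro finite_imageI finite_lists_length_eq) auto
qed

lemma finite_galois_polys: "finite (galois_polys H G \<Omega> act)"
  by (rule finite_subset[OF _ finite_monic_polys]) (auto simp: galois_polys_def)

lemma permutes_image_nsets:
  assumes "\<sigma> permutes {1..m}" "A \<in> nsets {1..m} k"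
  shows "\<sigma> ` A \<in> nsets {1..m} k"
  using assms permutes_inj_on[OF assms(1)] permutes_in_image[OF assms(1)]
  by (auto simp: nsets_def card_image)

lemma subset_action_Bij:
  assumes "\<sigma> permutes {1..m}"
  shows "subset_action m k \<sigma> \<in> Bij (nsets {1..m} k)"
  unfolding Bij_def
proof (intro IntI CollectI)
  show "subset_action m k \<sigma> \<in> extensional (nsets {1..m} k)"
    by (simp add: subset_action_def)
  have i: "Hilbert_Choice.inv \<sigma> permutes {1..m}" using assms by (rule permutes_inv)
  note img = permutes_image_nsets[OF assms] permutes_image_nsets[OF i]
  show "bij_betw (subset_action m k \<sigma>) (nsets {1..m} k) (nsets {1..m} k)"
    by (rule bij_betw_byWitness[where f' = "\<lambda>A. Hilbert_Choice.inv \<sigma> ` A"])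
      (auto simp: subset_action_def image_comp permutes_inv_o[OF assms] img
         simp del: One_nat_def)
qed

lemma group_action_subset_action:
  assumes "subgroup G (sym_group m)"
  shows "group_action (perm_subgroup m G) (nsets {1..m} k) (subset_action m k)"
proof (rule group_action.intro)
  interpret S: group "sym_group m" by (rule sym_group_is_group)
  have G: "group (perm_subgroup m G)" by (rule S.subgroup_imp_group[OF assms])
  have p: "\<sigma> permutes {1..m}" if "\<sigma> \<in> G" for \<sigma>
    using subgroup.subset[OF assms] that by (auto simp: sym_group_def)
  have "subset_action m k \<in> hom (perm_subgroup m G) (BijGroup (nsets {1..m} k))"
  proof (rule homI)
    fix \<sigma> \<tau> assume "\<sigma> \<in> carrier (perm_subgroup m G)" "\<tau> \<in> carrier (perm_subgroup m G)"
    then have "\<sigma> permutes {1..m}" "\<tau> permutes {1..m}" using p by auto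
    then have B: "subset_action m k \<sigma> \<in> Bij (nsets {1..m} k)"
      "subset_action m k \<tau> \<in> Bij (nsets {1..m} k)"
      and img: "\<And>A. A \<in> nsets {1..m} k \<Longrightarrow> \<tau> ` A \<in> nsets {1..m} k"
      by (auto intro: subset_action_Bij permutes_image_nsets simp del: One_nat_def)
    have "subset_action m k (\<sigma> \<circ> \<tau>) =
        compose (nsets {1..m} k) (subset_action m k \<sigma>) (subset_action m k \<tau>)"
      using img by (intro ext) (simp add: compose_def subset_action_def image_comp del: One_nat_def)
    then show "subset_action m k (\<sigma> \<otimes>\<^bsub>perm_subgroup m G\<^esub> \<tau>) =
        subset_action m k \<sigma> \<otimes>\<^bsub>BijGroup (nsets {1..m} k)\<^esub> subset_action m k \<tau>"
      using B by (simp add: BijGroup_def sym_group_def del: One_nat_def)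
  qed (simp add: BijGroup_def subset_action_Bij p del: One_nat_def)
  then show "group_hom (perm_subgroup m G) (BijGroup (nsets {1..m} k)) (subset_action m k)"
    using G group_BijGroup by (auto simp: group_hom_def group_hom_axioms_def)
qed

lemma faithful_action_subset_action:
  assumes "subgroup G (sym_group m)" and "1 \<le> k" and "k < m"
  shows "faithful_action (perm_subgroup m G) (nsets {1..m} k) (subset_action m k)"
proof (intro faithful_action.intro group_action_subset_action[OF assms(1)]
    faithful_action_axioms.intro inj_onI)
  fix \<sigma> \<tau> assume "\<sigma> \<in> carrier (perm_subgroup m G)" "\<tau> \<in> carrier (perm_subgroup m G)"
    and eq: "subset_action m k \<sigma> = subset_action m k \<tau>"
  then have p: "\<sigma> permutes {1..m}" "\<tau> permutes {1..m}"
    using subgroup.subset[OF assms(1)] by (auto simp: sym_group_def)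
  have img: "\<sigma> ` A = \<tau> ` A" if "A \<in> nsets {1..m} k" for A
    using fun_cong[OF eq, of A] that by (simp add: subset_action_def)
  show "\<sigma> = \<tau>"
  proof (rule ccontr)
    assume "\<sigma> \<noteq> \<tau>"
    then obtain x where x: "\<sigma> x \<noteq> \<tau> x" by auto
    then have xm: "x \<in> {1..m}" using p by (metis permutes_not_in)
    then have "\<tau> x \<in> {1..m}" using p by (meson permutes_in_image)
    then obtain y where y: "y \<in> {1..m}" "\<sigma> y = \<tau> x" using p
      by (metis imageE permutes_image)
    have "card ({1..m} - {x, y}) = m - card {x, y}" using xm y by (subst card_Diff_subset) auto
    moreover have "card {x, y} \<le> 2" by (simp add: card_insert_if)
    ultimately have "k - 1 \<le> card ({1..m} - {x, y})" using assms(2,3) by linarith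
    then obtain B where B: "B \<subseteq> {1..m} - {x, y}" "card B = k - 1" "finite B"
      by (metis obtain_subset_with_card_n)
    then have "insert x B \<in> nsets {1..m} k" using xm assms(2) by (auto simp: nsets_def card_insert_if)
    then have "\<sigma> y \<in> \<sigma> ` insert x B" using img y by blast
    then obtain z where z: "z \<in> insert x B" "\<sigma> z = \<sigma> y" by (metis imageE)
    then have "z = y" using permutes_inj[OF p(1)] by (meson injD)
    then show False using z B x y by auto
  qed
qed

lemma subgroup_Gal:
  assumes "ring L" and Q: "\<rat> \<subseteq> carrier L"
  shows "subgroup (carrier (Gal L)) (BijGroup (carrier L))"
proof -
  interpret ring L by fact
  interpret B: group "BijGroup (carrier L)" by (rule group_BijGroup)
  show ?thesis
  proof (rule B.subgroupI)
    show "carrier (Gal L) \<subseteq> carrier (BijGroup (carrier L))" by (auto simp: Gal_def BijGroup_def)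
    have "(\<lambda>x\<in>carrier L. x) \<in> carrier (Gal L)"
      using Q by (auto simp: Gal_def id_Bij bij_betw_def inj_on_def intro!: ring_iso_memI)
    then show "carrier (Gal L) \<noteq> {}" by blast
  next
    fix \<sigma> assume s: "\<sigma> \<in> carrier (Gal L)"
    then have sB: "\<sigma> \<in> Bij (carrier L)" and iso: "\<sigma> \<in> ring_iso L L" and fixQ: "\<forall>q\<in>\<rat>. \<sigma> q = q"
      by (auto simp: Gal_def)
    have inj: "inj_on \<sigma> (carrier L)" using sB by (simp add: Bij_def bij_betw_def)
    have "(\<lambda>x\<in>carrier L. inv_into (carrier L) \<sigma> x) \<in> ring_iso L L"
      by (rule ring_iso_restrict[OF ring_iso_set_sym[OF ring_axioms iso]]) simp
    moreover have "inv_into (carrier L) \<sigma> q = q" if "q \<in> \<rat>" for q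
      using inv_into_f_eq[OF inj] fixQ Q that by blast
    ultimately show "inv\<^bsub>BijGroup (carrier L)\<^esub> \<sigma> \<in> carrier (Gal L)"
      using Q by (auto simp: inv_BijGroup[OF sB] Gal_def restrict_inv_into_Bij[OF sB])
  next
    fix \<sigma> \<tau> assume "\<sigma> \<in> carrier (Gal L)" "\<tau> \<in> carrier (Gal L)"
    then have s: "\<sigma> \<in> Bij (carrier L)" "\<sigma> \<in> ring_iso L L" "\<forall>q\<in>\<rat>. \<sigma> q = q"
      and t: "\<tau> \<in> Bij (carrier L)" "\<tau> \<in> ring_iso L L" "\<forall>q\<in>\<rat>. \<tau> q = q"
      by (auto simp: Gal_def)
    have "compose (carrier L) \<sigma> \<tau> \<in> ring_iso L L"
      by (rule ring_iso_restrict[OF ring_iso_set_trans[OF t(2) s(2)]]) (simp add: compose_def)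
    moreover have "compose (carrier L) \<sigma> \<tau> q = q" if "q \<in> \<rat>" for q
      using that s t Q by (auto simp: compose_def)
    ultimately show "\<sigma> \<otimes>\<^bsub>BijGroup (carrier L)\<^esub> \<tau> \<in> carrier (Gal L)"
      using s(1) t(1) by (auto simp: BijGroup_def Gal_def compose_Bij)
  qed
qed

lemma rat_adjoin_facts:
  shows field_rat_adjoin: "field (rat_adjoin S)"
    and Rats_subset_rat_adjoin: "\<rat> \<subseteq> carrier (rat_adjoin S)"
    and subset_rat_adjoin: "S \<subseteq> carrier (rat_adjoin S)"
proof -
  interpret C: field "ring_of_type_algebra :: complex ring" by (rule field_from_type_algebra)
  show "field (rat_adjoin S)"
    unfolding rat_adjoin_def
    by (rule C.generate_field_is_field) (simp add: ring_of_type_algebra_def)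
  show "\<rat> \<subseteq> carrier (rat_adjoin S)" "S \<subseteq> carrier (rat_adjoin S)"
    by (auto simp: rat_adjoin_def intro: generate_field.incl)
qed

lemma group_galois_group: "group (galois_group f)"
proof -
  let ?L = "rat_adjoin (complex_roots f)"
  have "ring ?L" using field_rat_adjoin by (metis cring.axioms(1) domain.axioms(1) field.axioms(1))
  then have "subgroup (carrier (Gal ?L)) (BijGroup (carrier ?L))"
    using Rats_subset_rat_adjoin by (rule subgroup_Gal)
  from group.subgroup_imp_group[OF group_BijGroup this]
  show ?thesis by (simp add: galois_group_def Gal_def)
qed

end

theory Submission
  imports Defs "Jordan_Normal_Form.Char_Poly" "Berlekamp_Zassenhaus.Mahler_Measure"
begin

text \<open>Let \<open>n\<close> be the number of \<open>k\<close>-subsets of \<open>{1..m}\<close>, and let \<open>f\<close> be one of the polynomials to be counted.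
The isomorphism of permutation groups labels the roots of \<open>f\<close> as \<open>\<alpha>\<^sub>A\<close>, where \<open>A\<close> runs through the
\<open>k\<close>-subsets, in such a way that every automorphism acts on the labels through a permutation of the \<open>m\<close>
points (\<open>galois_polys_labelling\<close>). For a small integer \<open>c\<close>, form the \<open>m\<close> products
\<open>\<gamma>\<^sub>i = \<Prod>\<^sub>A\<^sub>\<ni>\<^sub>i (c - \<alpha>\<^sub>A)\<close>. Automorphisms permute them as they permute the points, so they are the roots of a
monic polynomial \<open>g\<close> of degree \<open>m\<close> with integer coefficients (\<open>esym_point_product_in_Ints\<close>).

By Landau's inequality, the product of all \<open>max 1 \<bar>\<alpha>\<^sub>A\<bar>\<close> is \<open>O(H)\<close>. A product of distinct \<open>\<gamma>\<^sub>i\<close> contains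
each \<open>c - \<alpha>\<^sub>A\<close> at most \<open>k\<close> times, so all coefficients of \<open>g\<close> are \<open>O(H\<^sup>k)\<close>. Moreover the constant term
of \<open>g\<close> is up to sign the \<open>k\<close>-th power of \<open>f(c) = O(H)\<close>. This leaves \<open>O(H\<^bsup>k(m-1)+1\<^esup>)\<close> pairs \<open>(g, f(c))\<close>.

It remains to bound the number of \<open>f\<close> that share the \<open>\<gamma>\<^sub>i\<close>. The shift \<open>c\<close> can be chosen such that the
\<open>\<gamma>\<^sub>i\<close> are distinct (\<open>exists_separating_shift\<close>); then they determine how an automorphism permutes the
points. If \<open>f\<close> and \<open>f'\<close> share the \<open>\<gamma>\<^sub>i\<close>, automorphisms therefore act in the same way on the labels of the
roots of \<open>f\<close> and of \<open>f'\<close>, and \<open>\<Prod>\<^sub>A (\<alpha>\<^sub>A - \<alpha>'\<^sub>A)\<close> is an integer, nonzero unless \<open>f = f'\<close>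
(\<open>difference_product_in_Ints\<close>). So the vectors \<open>(\<alpha>\<^sub>A)\<close> lie in the region where the product of
\<open>max 1 \<bar>\<alpha>\<^sub>A\<bar>\<close> is \<open>O(H)\<close>, and for any two of them the product of the coordinate differences is at least 1
in absolute value. Cutting the region into boxes shows that there are \<open>O(H\<^bsup>2+\<epsilon>\<^esup>)\<close> of them
(\<open>separated_family_card_le\<close>). Altogether the number of \<open>f\<close> is \<open>O(H\<^bsup>k(m-1)+3+\<epsilon>\<^esup>)\<close>, which is good enough
if \<open>k \<ge> 2\<close>; if \<open>k = 1\<close>, then \<open>n = m\<close> and the bound is trivial.

Automorphisms enter as embeddings of algebraic number fields into the complex numbers. The two facts
of Galois theory in use are that embeddings extend to larger fields (\<open>embedding_extends\<close>), which makes
it possible to act on the roots of \<open>f\<close> and \<open>f'\<close> simultaneously, and that an algebraic number fixed by all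
embeddings is rational (\<open>embedding_moves_irrational\<close>).\<close>

section \<open>Sums and products of algebraic integers\<close>

text \<open>\<open>z\<close> is an eigenvalue of an integer matrix, hence a root of its characteristic polynomial, which is
  monic with integer coefficients.\<close>
lemma algebraic_int_if_eigenvalue:
  fixes z :: complex and v :: "'i \<Rightarrow> complex" and A :: "'i \<Rightarrow> 'i \<Rightarrow> int"
  assumes "finite I" and "i0 \<in> I" and "v i0 \<noteq> 0"
    and eig: "\<And>i. i \<in> I \<Longrightarrow> z * v i = (\<Sum>j\<in>I. of_int (A i j) * v j)"
  shows "algebraic_int z"
proof -
  define N where "N = card I"
  obtain h where h: "bij_betw h {0..<N} I"
    using ex_bij_betw_nat_finite[OF \<open>finite I\<close>] N_def by blast
  define M where "M = mat N N (\<lambda>(i, j). A (h i) (h j))"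
  define M' :: "complex mat" where "M' = map_mat of_int M"
  define w where "w = vec N (\<lambda>i. v (h i))"
  have M: "M \<in> carrier_mat N N" and M': "M' \<in> carrier_mat N N"
    by (auto simp: M_def M'_def)
  have w: "w \<in> carrier_vec N" by (simp add: w_def)
  have hI: "h i \<in> I" if "i < N" for i using h that by (auto simp: bij_betw_def)
  have "M' *\<^sub>v w = z \<cdot>\<^sub>v w"
  proof (rule eq_vecI)
    fix i assume "i < dim_vec (z \<cdot>\<^sub>v w)"
    then have i: "i < N" by (simp add: w_def)
    have "(M' *\<^sub>v w) $ i = (\<Sum>j\<in>{0..<N}. of_int (A (h i) (h j)) * v (h j))"
      using i by (simp add: M'_def M_def w_def scalar_prod_def)
    also have "\<dots> = (\<Sum>j\<in>I. of_int (A (h i) j) * v j)"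
      by (rule sum.reindex_bij_betw[OF h])
    also have "\<dots> = z * v (h i)" using eig[OF hI[OF i]] by simp
    finally show "(M' *\<^sub>v w) $ i = (z \<cdot>\<^sub>v w) $ i" using i by (simp add: w_def)
  qed (simp add: M'_def M_def w_def)
  moreover have "w \<noteq> 0\<^sub>v N"
  proof
    assume w0: "w = 0\<^sub>v N"
    obtain i where "i < N" "h i = i0" using h \<open>i0 \<in> I\<close> by (auto simp: bij_betw_def)
    then have "w $ i = v i0" by (simp add: w_def)
    with w0 \<open>i < N\<close> \<open>v i0 \<noteq> 0\<close> show False by simp
  qed
  ultimately have "eigenvalue M' z"
    using M' w unfolding eigenvalue_def eigenvector_def by auto
  then have "poly (char_poly M') z = 0" using eigenvalue_root_char_poly[OF M'] by simp
  moreover have "char_poly M' = map_poly of_int (char_poly M)"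
    unfolding M'_def by (rule of_int_hom.char_poly_hom[OF M])
  moreover have "lead_coeff (char_poly M) = 1" using degree_monic_char_poly[OF M] by simp
  ultimately show ?thesis unfolding algebraic_int_altdef_ipoly by metis
qed

text \<open>For finite \<open>I\<close>: multiplication by \<open>z\<close> maps the additive group generated by the family \<open>v\<close> to itself.\<close>
definition int_stable :: "'i set \<Rightarrow> ('i \<Rightarrow> complex) \<Rightarrow> complex \<Rightarrow> bool" where
  "int_stable I v z \<longleftrightarrow> (\<forall>i\<in>I. \<exists>a::'i \<Rightarrow> int. z * v i = (\<Sum>j\<in>I. of_int (a j) * v j))"

lemma int_stable_add:
  assumes "int_stable I v x" "int_stable I v y"
  shows "int_stable I v (x + y)"
  unfolding int_stable_def
proof
  fix i assume "i \<in> I"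
  with assms obtain a b :: "'a \<Rightarrow> int"
    where "x * v i = (\<Sum>j\<in>I. of_int (a j) * v j)" "y * v i = (\<Sum>j\<in>I. of_int (b j) * v j)"
    unfolding int_stable_def by meson
  then have "(x + y) * v i = (\<Sum>j\<in>I. of_int (a j + b j) * v j)"
    by (simp add: ring_distribs sum.distrib)
  then show "\<exists>a::'a \<Rightarrow> int. (x + y) * v i = (\<Sum>j\<in>I. of_int (a j) * v j)"
    by (rule exI[where x = "\<lambda>j. a j + b j"])
qed

lemma int_stable_mult:
  assumes "int_stable I v x" "int_stable I v y"
  shows "int_stable I v (x * y)"
  unfolding int_stable_def
proof
  fix i assume "i \<in> I"
  obtain a :: "'a \<Rightarrow> 'a \<Rightarrow> int" where a: "\<And>i. i \<in> I \<Longrightarrow> x * v i = (\<Sum>j\<in>I. of_int (a i j) * v j)"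
    using assms(1) unfolding int_stable_def by metis
  obtain b :: "'a \<Rightarrow> int" where b: "y * v i = (\<Sum>j\<in>I. of_int (b j) * v j)"
    using assms(2) \<open>i \<in> I\<close> unfolding int_stable_def by meson
  have "x * y * v i = (\<Sum>j\<in>I. of_int (b j) * (x * v j))"
    using b by (simp add: mult.assoc sum_distrib_left mult.left_commute)
  also have "\<dots> = (\<Sum>j\<in>I. \<Sum>l\<in>I. of_int (b j * a j l) * v l)"
    by (intro sum.cong) (simp_all add: a sum_distrib_left mult.assoc)
  also have "\<dots> = (\<Sum>l\<in>I. of_int (\<Sum>j\<in>I. b j * a j l) * v l)"
    by (subst sum.swap) (simp add: sum_distrib_right)
  finally show "\<exists>a::'a \<Rightarrow> int. x * y * v i = (\<Sum>j\<in>I. of_int (a j) * v j)"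
    by (rule exI[where x = "\<lambda>l. \<Sum>j\<in>I. b j * a j l"])
qed

lemma algebraic_int_if_int_stable:
  assumes "finite I" "i0 \<in> I" "v i0 \<noteq> 0" "int_stable I v z"
  shows "algebraic_int z"
proof -
  obtain a :: "'a \<Rightarrow> 'a \<Rightarrow> int" where "\<And>i. i \<in> I \<Longrightarrow> z * v i = (\<Sum>j\<in>I. of_int (a i j) * v j)"
    using assms(4) unfolding int_stable_def by metis
  then show ?thesis using algebraic_int_if_eigenvalue[OF assms(1,2), of v] assms(3) by blast
qed

lemma algebraic_int_power_relation:
  fixes x :: complex
  assumes "algebraic_int x"
  obtains p and c :: "nat \<Rightarrow> int" where "0 < p" "x ^ p = (\<Sum>i<p. of_int (c i) * x ^ i)"
proof -
  from assms obtain f :: "int poly" where f: "poly (map_poly of_int f) x = 0" "lead_coeff f = 1"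
    unfolding algebraic_int_altdef_ipoly by blast
  let ?p = "degree f"
  have 0: "(\<Sum>i\<le>?p. of_int (coeff f i) * x ^ i) = 0"
    using f(1) by (simp add: poly_altdef degree_map_poly coeff_map_poly)
  have "0 < ?p"
  proof (rule ccontr)
    assume "\<not> 0 < ?p" with 0 f(2) show False by simp
  qed
  moreover have "x ^ ?p = (\<Sum>i<?p. of_int (- coeff f i) * x ^ i)"
    using 0 f(2) by (simp add: sum_negf lessThan_Suc_atMost[symmetric] add_eq_0_iff)
  ultimately show ?thesis by (rule that)
qed

text \<open>The powers of \<open>x\<close> from the \<open>p\<close>-th on can be rewritten in terms of the lower ones, so the monomials
  \<open>x\<^sup>i y\<^sup>j\<close> with \<open>i < p\<close> and \<open>j < q\<close> span a group stable under \<open>x\<close>. If \<open>y\<close> is treated alike, the same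
  group is stable under both numbers, hence under their sum and product.\<close>
lemma int_stable_monomials:
  assumes "x ^ p = (\<Sum>i<p. of_int (c i) * x ^ i)" "0 < p"
  shows "int_stable ({..<p} \<times> {..<q}) (\<lambda>(i, j). x ^ i * y ^ j) x"
  unfolding int_stable_def
proof clarify
  fix i j assume i: "i < p" and j: "j < q"
  let ?I = "{..<p} \<times> {..<q}"
  show "\<exists>a. x * (x ^ i * y ^ j) = (\<Sum>l\<in>?I. of_int (a l) * (case l of (i, j) \<Rightarrow> x ^ i * y ^ j))"
  proof (cases "Suc i < p")
    case True
    have "(\<Sum>l\<in>?I. of_int (if l = (Suc i, j) then 1 else 0) * (case l of (i, j) \<Rightarrow> x ^ i * y ^ j))
        = (\<Sum>l\<in>?I. if l = (Suc i, j) then x ^ Suc i * y ^ j else 0)"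
      by (intro sum.cong) auto
    also have "\<dots> = x * (x ^ i * y ^ j)" using True j by (subst sum.delta) auto
    finally have "x * (x ^ i * y ^ j)
        = (\<Sum>l\<in>?I. of_int (if l = (Suc i, j) then 1 else 0) * (case l of (i, j) \<Rightarrow> x ^ i * y ^ j))"
      by (rule sym)
    then show ?thesis by (rule exI[where x = "\<lambda>l. if l = (Suc i, j) then 1 else 0"])
  next
    case False
    then have p: "p = Suc i" using i by simp
    have "(\<Sum>l\<in>?I. of_int (if snd l = j then c (fst l) else 0) * (case l of (i, j) \<Rightarrow> x ^ i * y ^ j))
        = (\<Sum>i'<p. \<Sum>j'<q. of_int (if j' = j then c i' else 0) * (x ^ i' * y ^ j'))"
      by (simp add: sum.cartesian_product case_prod_beta)
    also have "\<dots> = (\<Sum>i'<p. of_int (c i') * x ^ i' * y ^ j)"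
    proof (intro sum.cong refl)
      fix i'
      have "(\<Sum>j'<q. of_int (if j' = j then c i' else 0) * (x ^ i' * y ^ j'))
          = (\<Sum>j'<q. if j' = j then of_int (c i') * x ^ i' * y ^ j else 0)"
        by (intro sum.cong) auto
      also have "\<dots> = of_int (c i') * x ^ i' * y ^ j" using j by (subst sum.delta) auto
      finally show "(\<Sum>j'<q. of_int (if j' = j then c i' else 0) * (x ^ i' * y ^ j')) = of_int (c i') * x ^ i' * y ^ j" .
    qed
    also have "\<dots> = x ^ p * y ^ j" by (simp add: assms(1) sum_distrib_right)
    also have "\<dots> = x * (x ^ i * y ^ j)" by (simp add: p)
    finally have "x * (x ^ i * y ^ j)
        = (\<Sum>l\<in>?I. of_int (if snd l = j then c (fst l) else 0) * (case l of (i, j) \<Rightarrow> x ^ i * y ^ j))"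
      by (rule sym)
    then show ?thesis by (rule exI[where x = "\<lambda>l. if snd l = j then c (fst l) else 0"])
  qed
qed

lemma
  fixes x y :: complex
  assumes x: "algebraic_int x" and y: "algebraic_int y"
  shows algebraic_int_add: "algebraic_int (x + y)"
    and algebraic_int_mult: "algebraic_int (x * y)"
proof -
  obtain p c where p: "0 < p" "x ^ p = (\<Sum>i<p. of_int (c i) * x ^ i)"
    using algebraic_int_power_relation[OF x] .
  obtain q d where q: "0 < q" "y ^ q = (\<Sum>i<q. of_int (d i) * y ^ i)"
    using algebraic_int_power_relation[OF y] .
  let ?I = "{..<p} \<times> {..<q}" and ?v = "\<lambda>(i, j). x ^ i * y ^ j"
  have sx: "int_stable ?I ?v x" using int_stable_monomials[OF p(2,1)] .
  have "int_stable ({..<q} \<times> {..<p}) (\<lambda>(i, j). y ^ i * x ^ j) y"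
    using int_stable_monomials[OF q(2,1)] .
  then have sy: "int_stable ?I ?v y"
  proof (unfold int_stable_def, clarify)
    fix i j assume *: "\<forall>i\<in>{..<q} \<times> {..<p}. \<exists>a. y * (case i of (i, j) \<Rightarrow> y ^ i * x ^ j)
        = (\<Sum>j\<in>{..<q} \<times> {..<p}. of_int (a j) * (case j of (i, j) \<Rightarrow> y ^ i * x ^ j))"
      and ij: "i < p" "j < q"
    then obtain a where a: "y * (y ^ j * x ^ i)
        = (\<Sum>l\<in>{..<q} \<times> {..<p}. of_int (a l) * (case l of (i, j) \<Rightarrow> y ^ i * x ^ j))"
      by fastforce
    have "(\<Sum>l\<in>{..<q} \<times> {..<p}. of_int (a l) * (case l of (i, j) \<Rightarrow> y ^ i * x ^ j))
        = (\<Sum>l\<in>?I. of_int (a (prod.swap l)) * (case l of (i, j) \<Rightarrow> x ^ i * y ^ j))"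
      by (rule sum.reindex_bij_witness[of _ prod.swap prod.swap]) (auto simp: mult.commute)
    with a have "y * (x ^ i * y ^ j)
        = (\<Sum>l\<in>?I. of_int (a (prod.swap l)) * (case l of (i, j) \<Rightarrow> x ^ i * y ^ j))"
      by (simp add: mult.commute)
    then show "\<exists>a. y * (x ^ i * y ^ j) = (\<Sum>l\<in>?I. of_int (a l) * (case l of (i, j) \<Rightarrow> x ^ i * y ^ j))"
      by (rule exI[where x = "\<lambda>l. a (prod.swap l)"])
  qed
  have I: "finite ?I" "(0, 0) \<in> ?I" "?v (0, 0) \<noteq> 0" using p(1) q(1) by auto
  show "algebraic_int (x + y)"
    using algebraic_int_if_int_stable[OF I int_stable_add[OF sx sy]] .
  show "algebraic_int (x * y)"
    using algebraic_int_if_int_stable[OF I int_stable_mult[OF sx sy]] .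
qed

lemma algebraic_int_sum:
  fixes f :: "'a \<Rightarrow> complex"
  assumes "\<And>i. i \<in> I \<Longrightarrow> algebraic_int (f i)"
  shows "algebraic_int (sum f I)"
  using assms by (induction I rule: infinite_finite_induct) (auto intro: algebraic_int_add)

lemma algebraic_int_prod:
  fixes f :: "'a \<Rightarrow> complex"
  assumes "\<And>i. i \<in> I \<Longrightarrow> algebraic_int (f i)"
  shows "algebraic_int (prod f I)"
  using assms by (induction I rule: infinite_finite_induct) (auto intro: algebraic_int_mult)


section \<open>Embeddings of algebraic fields\<close>

text \<open>These are the algebraic numbers. Writing them as algebraic integers divided by integers reduces
  closure under sums and products to the case of algebraic integers.\<close>
definition alg_num :: "complex \<Rightarrow> bool" where
  "alg_num z \<longleftrightarrow> (\<exists>d::int. d \<noteq> 0 \<and> algebraic_int (of_int d * z))"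

lemma alg_num_algebraic_int: "algebraic_int z \<Longrightarrow> alg_num z"
  unfolding alg_num_def by (rule exI[of _ 1]) simp

lemma
  assumes "alg_num x" "alg_num y"
  shows alg_num_add: "alg_num (x + y)" and alg_num_mult: "alg_num (x * y)"
proof -
  obtain d e where d: "d \<noteq> 0" "algebraic_int (of_int d * x)"
    and e: "e \<noteq> 0" "algebraic_int (of_int e * y)"
    using assms unfolding alg_num_def by blast
  have i: "algebraic_int (of_int n :: complex)" for n by simp
  have "algebraic_int (of_int e * (of_int d * x) + of_int d * (of_int e * y))"
    by (rule algebraic_int_add[OF algebraic_int_mult[OF i d(2)] algebraic_int_mult[OF i e(2)]])
  also have "of_int e * (of_int d * x) + of_int d * (of_int e * y) = of_int (d * e) * (x + y)"
    by (simp add: algebra_simps)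
  finally show "alg_num (x + y)" using d(1) e(1) unfolding alg_num_def
    by (metis no_zero_divisors)
  have "algebraic_int ((of_int d * x) * (of_int e * y))" by (rule algebraic_int_mult[OF d(2) e(2)])
  also have "(of_int d * x) * (of_int e * y) = of_int (d * e) * (x * y)"
    by (simp add: algebra_simps)
  finally show "alg_num (x * y)" using d(1) e(1) unfolding alg_num_def
    by (metis no_zero_divisors)
qed

lemma alg_num_Rats:
  assumes "q \<in> \<rat>" shows "alg_num q"
proof -
  from assms obtain a b :: int where "b > 0" "q = of_int a / of_int b" by (elim Rats_cases') auto
  then have "algebraic_int (of_int b * q)" by simp
  with \<open>b > 0\<close> show ?thesis unfolding alg_num_def by (intro exI[of _ b]) simp
qed

definition poly_over :: "complex set \<Rightarrow> complex poly \<Rightarrow> bool" where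
  "poly_over K p \<longleftrightarrow> (\<forall>i. coeff p i \<in> K)"

text \<open>The usual minimal polynomial up to a scalar factor.\<close>
definition minimal_poly :: "complex set \<Rightarrow> complex poly \<Rightarrow> complex \<Rightarrow> bool" where
  "minimal_poly K \<mu> \<alpha> \<longleftrightarrow> poly_over K \<mu> \<and> \<mu> \<noteq> 0 \<and> poly \<mu> \<alpha> = 0 \<and>
     (\<forall>p. poly_over K p \<longrightarrow> p \<noteq> 0 \<longrightarrow> poly p \<alpha> = 0 \<longrightarrow> degree \<mu> \<le> degree p)"

text \<open>The axioms are those of a ring; that such a ring is a field, see \<open>inverse\<close> below, follows from
  the algebraicity of its elements.\<close>
locale algebraic_field =
  fixes K :: "complex set"
  assumes Rats: "\<rat> \<subseteq> K"
    and add: "x \<in> K \<Longrightarrow> y \<in> K \<Longrightarrow> x + y \<in> K"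
    and mult: "x \<in> K \<Longrightarrow> y \<in> K \<Longrightarrow> x * y \<in> K"
    and alg_num: "x \<in> K \<Longrightarrow> alg_num x"
begin

lemma of_int: "of_int i \<in> K" and zero: "0 \<in> K" and one: "1 \<in> K"
  using Rats by auto

lemma uminus: "x \<in> K \<Longrightarrow> - x \<in> K"
  using mult[of "of_int (- 1)" x] of_int[of "- 1"] by simp

lemma diff: "x \<in> K \<Longrightarrow> y \<in> K \<Longrightarrow> x - y \<in> K"
  using add[of x "- y"] uminus by simp

lemma power: "x \<in> K \<Longrightarrow> x ^ n \<in> K"
  by (induction n) (auto intro: one mult)

lemma sum: "(\<And>i. i \<in> I \<Longrightarrow> f i \<in> K) \<Longrightarrow> sum f I \<in> K"
  by (induction I rule: infinite_finite_induct) (auto intro: zero add)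

lemma prod: "(\<And>i. i \<in> I \<Longrightarrow> f i \<in> K) \<Longrightarrow> prod f I \<in> K"
  by (induction I rule: infinite_finite_induct) (auto intro: one mult)

lemma poly_in: "poly_over K p \<Longrightarrow> x \<in> K \<Longrightarrow> poly p x \<in> K"
  unfolding poly_over_def poly_altdef by (intro sum mult power) auto

lemma poly_over_const: "c \<in> K \<Longrightarrow> poly_over K [:c:]"
  by (auto simp: poly_over_def coeff_pCons zero split: nat.split)

lemma poly_over_map_of_int: "poly_over K (map_poly of_int f)"
  by (auto simp: poly_over_def coeff_map_poly of_int)

lemma poly_over_add: "poly_over K p \<Longrightarrow> poly_over K q \<Longrightarrow> poly_over K (p + q)"
  by (auto simp: poly_over_def add)

lemma poly_over_diff: "poly_over K p \<Longrightarrow> poly_over K q \<Longrightarrow> poly_over K (p - q)"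
  by (auto simp: poly_over_def diff)

lemma poly_over_smult: "c \<in> K \<Longrightarrow> poly_over K q \<Longrightarrow> poly_over K (smult c q)"
  by (auto simp: poly_over_def mult)

lemma poly_over_mult: "poly_over K p \<Longrightarrow> poly_over K q \<Longrightarrow> poly_over K (p * q)"
  by (auto simp: poly_over_def coeff_mult intro: sum mult)

lemma poly_over_monom: "c \<in> K \<Longrightarrow> poly_over K (monom c n)"
  by (auto simp: poly_over_def zero)

lemma poly_over_pderiv: "poly_over K p \<Longrightarrow> poly_over K (pderiv p)"
  using of_int[of "int (Suc n)" for n] by (auto simp: poly_over_def coeff_pderiv simp del: of_nat_Suc intro!: mult)

text \<open>If \<open>w\<close> is a nonzero algebraic integer, an integer polynomial of least degree that vanishes at \<open>w\<close> has
  a nonzero constant term \<open>a\<close>; solving \<open>a + w * q(w) = 0\<close> expresses \<open>1 / w\<close> as a polynomial in \<open>w\<close>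
  with rational coefficients.\<close>
lemma inverse:
  assumes "x \<in> K" shows "inverse x \<in> K"
proof (cases "x = 0")
  case False
  obtain d :: int where d: "d \<noteq> 0" "algebraic_int (of_int d * x)"
    using alg_num[OF assms] unfolding alg_num_def by blast
  define w where "w = of_int d * x"
  have w: "w \<in> K" "w \<noteq> 0" using assms d False by (auto simp: w_def intro: mult of_int)
  have "\<exists>p::int poly. p \<noteq> 0 \<and> poly (map_poly of_int p) w = 0"
  proof -
    obtain f :: "int poly" where "poly (map_poly of_int f) w = 0" "lead_coeff f = 1"
      using d(2) unfolding algebraic_int_altdef_ipoly w_def by blast
    then show ?thesis by (intro exI[of _ f]) auto
  qed
  then obtain p :: "int poly" where p: "p \<noteq> 0" "poly (map_poly of_int p) w = 0"
    and least: "\<And>q::int poly. q \<noteq> 0 \<Longrightarrow> poly (map_poly of_int q) w = 0 \<Longrightarrow> degree p \<le> degree q"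
    using ex_has_least_nat[of "\<lambda>p::int poly. p \<noteq> 0 \<and> poly (map_poly of_int p) w = 0" _ degree] by (metis (no_types, lifting))
  obtain a q where pq: "p = pCons a q" by (cases p)
  have eq: "of_int a + w * poly (map_poly of_int q) w = 0"
    using p(2) by (simp add: pq Polynomial.map_poly_pCons)
  have "a \<noteq> 0"
  proof
    assume "a = 0"
    then have "q \<noteq> 0" "poly (map_poly of_int q) w = 0" using eq w(2) p(1) pq by auto
    with least[of q] pq show False by simp
  qed
  have "w * (- (poly (map_poly of_int q) w * of_rat (1 / of_int a)))
      = - (w * poly (map_poly of_int q) w) * of_rat (1 / of_int a)"
    by simp
  also have "- (w * poly (map_poly of_int q) w) = of_int a" using eq by (simp add: add_eq_0_iff)
  also have "of_int a * of_rat (1 / of_int a) = (1 :: complex)"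
    using \<open>a \<noteq> 0\<close> by (simp add: of_rat_divide)
  finally have "w * (- (poly (map_poly of_int q) w * of_rat (1 / of_int a))) = 1" .
  then have "x * (of_int d * (- (poly (map_poly of_int q) w * of_rat (1 / of_int a)))) = 1"
    by (simp add: w_def mult_ac)
  then have "inverse x = of_int d * (- (poly (map_poly of_int q) w * of_rat (1 / of_int a)))"
    by (rule inverse_unique)
  moreover have "of_rat (1 / of_int a) \<in> K" using Rats by auto
  ultimately show ?thesis
    using w(1) by (auto intro!: mult uminus of_int poly_in poly_over_map_of_int)
qed (simp add: zero)

end

text \<open>A field homomorphism into the complex numbers, whose values outside \<open>K\<close> are arbitrary.\<close>
locale embedding = algebraic_field K for K +
  fixes \<sigma> :: "complex \<Rightarrow> complex"
  assumes hom_Rats: "q \<in> \<rat> \<Longrightarrow> \<sigma> q = q"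
    and hom_add: "x \<in> K \<Longrightarrow> y \<in> K \<Longrightarrow> \<sigma> (x + y) = \<sigma> x + \<sigma> y"
    and hom_mult: "x \<in> K \<Longrightarrow> y \<in> K \<Longrightarrow> \<sigma> (x * y) = \<sigma> x * \<sigma> y"
begin

lemma hom_of_int [simp]: "\<sigma> (of_int i) = of_int i" by (simp add: hom_Rats)
lemma hom_0 [simp]: "\<sigma> 0 = 0" by (simp add: hom_Rats)
lemma hom_1 [simp]: "\<sigma> 1 = 1" by (simp add: hom_Rats)

lemma hom_uminus: "x \<in> K \<Longrightarrow> \<sigma> (- x) = - \<sigma> x"
  using hom_mult[of "of_int (- 1)" x] of_int[of "- 1"] hom_of_int[of "- 1"] by simp

lemma hom_diff: "x \<in> K \<Longrightarrow> y \<in> K \<Longrightarrow> \<sigma> (x - y) = \<sigma> x - \<sigma> y"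
  using hom_add[of x "- y"] uminus hom_uminus by simp

lemma hom_power: "x \<in> K \<Longrightarrow> \<sigma> (x ^ n) = \<sigma> x ^ n"
  by (induction n) (auto simp: hom_mult power)

lemma hom_sum: "(\<And>i. i \<in> I \<Longrightarrow> f i \<in> K) \<Longrightarrow> \<sigma> (\<Sum>i\<in>I. f i) = (\<Sum>i\<in>I. \<sigma> (f i))"
  by (induction I rule: infinite_finite_induct) (auto simp: hom_add sum)

lemma hom_prod: "(\<And>i. i \<in> I \<Longrightarrow> f i \<in> K) \<Longrightarrow> \<sigma> (\<Prod>i\<in>I. f i) = (\<Prod>i\<in>I. \<sigma> (f i))"
  by (induction I rule: infinite_finite_induct) (auto simp: hom_mult prod)

lemma hom_inverse:
  assumes "x \<in> K" shows "\<sigma> (inverse x) = inverse (\<sigma> x)"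
proof (cases "x = 0")
  case False
  then have "\<sigma> x * \<sigma> (inverse x) = 1" using hom_mult[OF assms inverse[OF assms]] by simp
  then show ?thesis by (metis inverse_unique)
qed simp

lemma hom_eq_0: "x \<in> K \<Longrightarrow> \<sigma> x = 0 \<longleftrightarrow> x = 0"
proof
  assume x: "x \<in> K" "\<sigma> x = 0"
  show "x = 0"
  proof (rule ccontr)
    assume "x \<noteq> 0"
    then have "\<sigma> x * \<sigma> (inverse x) = 1" using hom_mult[OF x(1) inverse[OF x(1)]] by simp
    with x(2) show False by simp
  qed
qed simp

lemma inj_on_hom: "inj_on \<sigma> K"
  by (rule inj_onI) (metis diff hom_diff hom_eq_0 right_minus_eq)

lemma coeff_map_hom [simp]: "coeff (map_poly \<sigma> p) i = \<sigma> (coeff p i)"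
  by (simp add: coeff_map_poly)

lemma map_hom_add:
  "poly_over K p \<Longrightarrow> poly_over K q \<Longrightarrow> map_poly \<sigma> (p + q) = map_poly \<sigma> p + map_poly \<sigma> q"
  by (rule poly_eqI) (simp add: poly_over_def hom_add)

lemma map_hom_diff:
  "poly_over K p \<Longrightarrow> poly_over K q \<Longrightarrow> map_poly \<sigma> (p - q) = map_poly \<sigma> p - map_poly \<sigma> q"
  by (rule poly_eqI) (simp add: poly_over_def hom_diff)

lemma map_hom_mult:
  "poly_over K p \<Longrightarrow> poly_over K q \<Longrightarrow> map_poly \<sigma> (p * q) = map_poly \<sigma> p * map_poly \<sigma> q"
  by (rule poly_eqI) (simp add: poly_over_def coeff_mult hom_mult hom_sum mult)

lemma map_hom_smult:
  "c \<in> K \<Longrightarrow> poly_over K q \<Longrightarrow> map_poly \<sigma> (smult c q) = smult (\<sigma> c) (map_poly \<sigma> q)"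
  by (rule poly_eqI) (simp add: poly_over_def hom_mult)

lemma map_hom_const: "map_poly \<sigma> [:c:] = [:\<sigma> c:]"
  by (rule poly_eqI) (simp add: coeff_pCons split: nat.split)

lemma degree_map_hom:
  assumes "poly_over K p" shows "degree (map_poly \<sigma> p) = degree p"
proof (cases "p = 0")
  case False
  then have "coeff (map_poly \<sigma> p) (degree p) \<noteq> 0"
    using assms by (simp add: hom_eq_0 poly_over_def)
  then show ?thesis by (intro antisym degree_map_poly_le le_degree)
qed simp

lemma hom_poly:
  assumes "poly_over K p" "x \<in> K"
  shows "\<sigma> (poly p x) = poly (map_poly \<sigma> p) (\<sigma> x)"
proof -
  have "\<sigma> (poly p x) = (\<Sum>i\<le>degree p. \<sigma> (coeff p i) * \<sigma> x ^ i)"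
    using assms unfolding poly_altdef poly_over_def
    by (subst hom_sum) (auto intro!: mult power sum.cong simp: hom_mult hom_power power)
  also have "\<dots> = poly (map_poly \<sigma> p) (\<sigma> x)"
    using assms(1) by (simp add: poly_altdef degree_map_hom)
  finally show ?thesis .
qed

text \<open>Cancelling the leading term of \<open>p\<close> against a multiple of \<open>\<mu>\<close>, after scaling \<open>p\<close> by the leading
  coefficient of \<open>\<mu>\<close>, lowers the degree and preserves the vanishing at \<open>\<alpha>\<close>; what was subtracted
  vanishes at \<open>\<beta>\<close> after applying \<open>\<sigma>\<close>.\<close>
lemma conjugate_root:
  assumes min: "minimal_poly K \<mu> \<alpha>"
    and \<beta>: "poly (map_poly \<sigma> \<mu>) \<beta> = 0"
    and p: "poly_over K p" "poly p \<alpha> = 0"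
  shows "poly (map_poly \<sigma> p) \<beta> = 0"
  using p
proof (induction "degree p" arbitrary: p rule: less_induct)
  case less
  show ?case
  proof (cases "p = 0")
    case False
    have \<mu>: "poly_over K \<mu>" "\<mu> \<noteq> 0" "poly \<mu> \<alpha> = 0" and deg: "degree \<mu> \<le> degree p"
      using min less.prems False unfolding minimal_poly_def by auto
    define l where "l = lead_coeff \<mu>"
    define q where "q = monom (lead_coeff p) (degree p - degree \<mu>) * \<mu>"
    define r where "r = smult l p - q"
    have lK: "l \<in> K" and cK: "lead_coeff p \<in> K"
      using \<mu>(1) less.prems by (auto simp: l_def poly_over_def)
    have over: "poly_over K q" "poly_over K (smult l p)"
      unfolding q_def using lK cK \<mu>(1) less.prems by (auto intro: poly_over_mult poly_over_monom poly_over_smult)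
    have "degree p > 0"
    proof (rule ccontr)
      assume "\<not> degree p > 0"
      then obtain c where "p = [:c:]" by (metis degree_eq_zeroE gr0I)
      with less.prems False show False by simp
    qed
    moreover have "coeff r k = 0" if "k \<ge> degree p" for k
    proof (cases "k = degree p")
      case True
      then show ?thesis using deg by (simp add: r_def q_def l_def coeff_monom_mult)
    next
      case False
      then show ?thesis using that deg
        by (auto simp: r_def q_def coeff_monom_mult coeff_eq_0)
    qed
    ultimately have "degree r < degree p" by (intro degree_lessI) auto
    moreover have "poly r \<alpha> = 0" using less.prems \<mu>(3) by (simp add: r_def q_def)
    moreover have "poly_over K r" unfolding r_def using over by (intro poly_over_diff)
    ultimately have "poly (map_poly \<sigma> r) \<beta> = 0" using less.hyps by blast
    moreover have "poly (map_poly \<sigma> q) \<beta> = 0"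
      unfolding q_def using cK \<mu>(1) \<beta> by (subst map_hom_mult) (auto intro: poly_over_monom)
    ultimately have "\<sigma> l * poly (map_poly \<sigma> p) \<beta> = 0"
      unfolding r_def using over lK less.prems by (simp add: map_hom_diff map_hom_smult)
    moreover have "\<sigma> l \<noteq> 0" using lK \<mu>(2) by (simp add: hom_eq_0 l_def)
    ultimately show ?thesis by simp
  qed simp
qed

text \<open>The extension sends \<open>p(\<alpha>)\<close> to \<open>(\<sigma> p)(\<beta>)\<close>, and \<open>conjugate_root\<close> says that this is well defined.\<close>
lemma extend_by_one:
  assumes min: "minimal_poly K \<mu> \<alpha>"
    and \<beta>: "poly (map_poly \<sigma> \<mu>) \<beta> = 0"
    and \<alpha>: "alg_num \<alpha>"
  obtains K' \<tau> where "embedding K' \<tau>" "K \<subseteq> K'" "\<alpha> \<in> K'" "\<tau> \<alpha> = \<beta>" "\<And>x. x \<in> K \<Longrightarrow> \<tau> x = \<sigma> x"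
proof -
  define K' where "K' = {poly p \<alpha> | p. poly_over K p}"
  define \<tau> where "\<tau> x = poly (map_poly \<sigma> (SOME p. poly_over K p \<and> poly p \<alpha> = x)) \<beta>" for x
  have \<tau>: "\<tau> (poly p \<alpha>) = poly (map_poly \<sigma> p) \<beta>" if p: "poly_over K p" for p
  proof -
    define q where "q = (SOME q. poly_over K q \<and> poly q \<alpha> = poly p \<alpha>)"
    have q: "poly_over K q \<and> poly q \<alpha> = poly p \<alpha>" unfolding q_def by (rule someI[of _ p]) (use p in simp)
    then have "poly (map_poly \<sigma> (q - p)) \<beta> = 0"
      using p by (intro conjugate_root[OF min \<beta>]) (auto intro: poly_over_diff)
    then show ?thesis using q p by (simp add: map_hom_diff \<tau>_def flip: q_def)
  qed
  have const: "\<tau> c = \<sigma> c" "c \<in> K'" if "c \<in> K" for c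
  proof -
    show "\<tau> c = \<sigma> c" using \<tau>[OF poly_over_const[OF that]] by (simp add: map_hom_const)
    have "c = poly [:c:] \<alpha>" by simp
    then show "c \<in> K'" unfolding K'_def using poly_over_const[OF that] by blast
  qed
  have alg: "alg_num (poly p \<alpha>)" if "poly_over K p" for p
  proof -
    have pow: "alg_num (\<alpha> ^ i)" for i
      by (induction i) (auto intro: alg_num_mult \<alpha> alg_num_Rats)
    have "alg_num (\<Sum>i\<in>A. coeff p i * \<alpha> ^ i)" if "finite A" for A
      using that \<open>poly_over K p\<close>
      by (induction A rule: finite_induct)
        (auto intro!: alg_num_add alg_num_mult pow intro: alg_num_Rats alg_num simp: poly_over_def)
    then show ?thesis by (simp add: poly_altdef)
  qed
  have "embedding K' \<tau>"
  proof
    show "\<rat> \<subseteq> K'" using Rats const(2) by blast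
    show "\<tau> q = q" if "q \<in> \<rat>" for q using const(1)[of q] that Rats hom_Rats by auto
    fix x assume "x \<in> K'"
    then obtain p where p: "poly_over K p" "x = poly p \<alpha>" by (auto simp: K'_def)
    show "alg_num x" using alg p by simp
    fix y assume "y \<in> K'"
    then obtain q where q: "poly_over K q" "y = poly q \<alpha>" by (auto simp: K'_def)
    have *: "x + y = poly (p + q) \<alpha>" "x * y = poly (p * q) \<alpha>" using p q by auto
    show "x + y \<in> K'" "x * y \<in> K'" unfolding K'_def * using p(1) q(1) poly_over_add poly_over_mult by blast+
    show "\<tau> (x + y) = \<tau> x + \<tau> y"
      unfolding *(1) using p q by (subst \<tau>) (simp_all add: \<tau> poly_over_add map_hom_add)
    show "\<tau> (x * y) = \<tau> x * \<tau> y"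
      unfolding *(2) using p q by (subst \<tau>) (simp_all add: \<tau> poly_over_mult map_hom_mult)
  qed
  moreover have "K \<subseteq> K'" using const(2) by blast
  moreover have X: "poly_over K (monom 1 1)" by (intro poly_over_monom one)
  have "\<alpha> = poly (monom 1 1) \<alpha>" by (simp add: poly_monom)
  then have "\<alpha> \<in> K'" unfolding K'_def using X by blast
  moreover have "\<tau> \<alpha> = \<beta>"
  proof -
    have "map_poly \<sigma> (monom 1 1) = monom 1 1" by (rule poly_eqI) (simp add: coeff_monom)
    then show ?thesis using \<tau>[OF X] by (simp add: poly_monom)
  qed
  ultimately show ?thesis using const(1) by (rule that)
qed

end

lemma (in algebraic_field) minimal_poly_exists:
  assumes "algebraic_int \<alpha>"
  obtains \<mu> where "minimal_poly K \<mu> \<alpha>"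
proof -
  obtain f :: "int poly" where "poly (map_poly of_int f) \<alpha> = 0" "lead_coeff f = 1"
    using assms unfolding algebraic_int_altdef_ipoly by blast
  then have "poly_over K (map_poly of_int f) \<and> (map_poly of_int f :: complex poly) \<noteq> 0
      \<and> poly (map_poly of_int f) \<alpha> = 0"
    using poly_over_map_of_int by auto
  from ex_has_least_nat[of "\<lambda>p. poly_over K p \<and> p \<noteq> 0 \<and> poly p \<alpha> = 0", OF this, of degree]
  show ?thesis using that unfolding minimal_poly_def by blast
qed

lemma minimal_poly_degree_pos:
  assumes "minimal_poly K \<mu> \<alpha>" shows "degree \<mu> > 0"
proof (rule ccontr)
  assume "\<not> degree \<mu> > 0"
  then obtain c where "\<mu> = [:c:]" by (metis degree_eq_zeroE gr0I)
  with assms show False by (simp add: minimal_poly_def)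
qed

text \<open>One element \<open>s\<close> is adjoined at a time: the image of its minimal polynomial has positive degree,
  hence a complex root, and any such root may serve as the image of \<open>s\<close>.\<close>
theorem embedding_extends:
  assumes "finite S" "\<And>s. s \<in> S \<Longrightarrow> algebraic_int s" "embedding K \<sigma>"
  shows "\<exists>K' \<tau>. embedding K' \<tau> \<and> K \<subseteq> K' \<and> S \<subseteq> K' \<and> (\<forall>x\<in>K. \<tau> x = \<sigma> x)"
  using assms(1,2)
proof (induction S rule: finite_induct)
  case empty
  then show ?case using assms(3) by blast
next
  case (insert s S)
  then obtain K' \<tau> where K': "embedding K' \<tau>" "K \<subseteq> K'" "S \<subseteq> K'" "\<And>x. x \<in> K \<Longrightarrow> \<tau> x = \<sigma> x"
    by auto
  interpret embedding K' \<tau> by fact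
  have s: "algebraic_int s" using insert by simp
  obtain \<mu> where \<mu>: "minimal_poly K' \<mu> s" using minimal_poly_exists[OF s] .
  then have "poly_over K' \<mu>" by (simp add: minimal_poly_def)
  then have "\<not> constant (poly (map_poly \<tau> \<mu>))"
    using minimal_poly_degree_pos[OF \<mu>] degree_map_hom by (simp add: constant_degree)
  then obtain \<beta> where \<beta>: "poly (map_poly \<tau> \<mu>) \<beta> = 0" using fundamental_theorem_of_algebra by blast
  obtain L \<rho> where "embedding L \<rho>" "K' \<subseteq> L" "s \<in> L" "\<And>x. x \<in> K' \<Longrightarrow> \<rho> x = \<tau> x"
    using extend_by_one[OF \<mu> \<beta> alg_num_algebraic_int[OF s]] by blast
  then show ?case using K' by (intro exI[of _ L] exI[of _ \<rho>]) auto
qed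

lemma embedding_Rats: "embedding \<rat> (\<lambda>x. x)"
  by unfold_locales (auto intro: alg_num_Rats)

text \<open>The minimal polynomial of an irrational \<open>z\<close> over the rationals has degree at least 2, and \<open>z\<close> is
  only a simple root of it because the derivative has smaller degree. So there is a root \<open>\<beta>\<close> other
  than \<open>z\<close>, and \<open>z\<close> can be mapped to \<open>\<beta>\<close>.\<close>
theorem embedding_moves_irrational:
  assumes "algebraic_int z" "z \<notin> \<rat>"
  obtains K \<tau> where "embedding K \<tau>" "z \<in> K" "\<tau> z \<noteq> z"
proof -
  interpret algebraic_field \<rat> using embedding_Rats by (rule embedding.axioms)
  obtain \<mu> where min: "minimal_poly \<rat> \<mu> z" using minimal_poly_exists[OF assms(1)] .
  then have \<mu>: "poly_over \<rat> \<mu>" "\<mu> \<noteq> 0" "poly \<mu> z = 0" "degree \<mu> > 0"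
    and least: "\<And>p. poly_over \<rat> p \<Longrightarrow> p \<noteq> 0 \<Longrightarrow> poly p z = 0 \<Longrightarrow> degree \<mu> \<le> degree p"
    using minimal_poly_degree_pos[OF min] unfolding minimal_poly_def by auto
  have id: "map_poly (\<lambda>x. x) \<mu> = \<mu>" by (rule poly_eqI) (simp add: coeff_map_poly)
  obtain \<nu> where \<nu>: "\<mu> = [:- z, 1:] * \<nu>" using \<mu>(3) poly_eq_0_iff_dvd by (metis dvdE)
  then have "\<nu> \<noteq> 0" using \<mu>(2) by (metis mult_zero_right)
  have "pderiv \<mu> \<noteq> 0" "degree (pderiv \<mu>) < degree \<mu>"
    using \<mu>(4) by (auto simp: pderiv_eq_0_iff degree_pderiv)
  then have "poly (pderiv \<mu>) z \<noteq> 0" using least[OF poly_over_pderiv[OF \<mu>(1)]] by force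
  moreover have "poly (pderiv \<mu>) z = poly \<nu> z" unfolding \<nu> pderiv_mult by (simp add: pderiv_pCons)
  ultimately have nz: "poly \<nu> z \<noteq> 0" by simp
  have "degree \<nu> > 0"
  proof (rule ccontr)
    assume "\<not> degree \<nu> > 0"
    then obtain c where c: "\<nu> = [:c:]" by (metis degree_eq_zeroE gr0I)
    then have "coeff \<mu> 0 = - z * c" "coeff \<mu> 1 = c" by (simp_all add: \<nu>)
    moreover have "c \<noteq> 0" using c \<open>\<nu> \<noteq> 0\<close> by auto
    ultimately have "z = - (coeff \<mu> 0 / coeff \<mu> 1)" by simp
    also have "\<dots> \<in> \<rat>" using \<mu>(1) unfolding poly_over_def by (intro Rats_minus_iff[THEN iffD2] Rats_divide) auto
    finally show False using assms(2) by simp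
  qed
  then have "\<not> constant (poly \<nu>)" by (simp add: constant_degree)
  then obtain \<beta> where \<beta>: "poly \<nu> \<beta> = 0" using fundamental_theorem_of_algebra by blast
  then have "\<beta> \<noteq> z" using nz by auto
  moreover have "poly (map_poly (\<lambda>x. x) \<mu>) \<beta> = 0" unfolding id using \<beta> by (simp add: \<nu>)
  ultimately show ?thesis
    using embedding.extend_by_one[OF embedding_Rats min _ alg_num_algebraic_int[OF assms(1)]] that by metis
qed


section \<open>Galois groups and embeddings\<close>

lemma rat_adjoin_simps:
  "x \<otimes>\<^bsub>rat_adjoin S\<^esub> y = x * y" "x \<oplus>\<^bsub>rat_adjoin S\<^esub> y = x + y"
  "\<one>\<^bsub>rat_adjoin S\<^esub> = 1"
  by (simp_all add: rat_adjoin_def ring_of_type_algebra_def)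

lemma rat_adjoin_induct [consumes 1, case_names Rats gen uminus inverse add mult]:
  assumes "x \<in> carrier (rat_adjoin S)"
    and "\<And>q. q \<in> \<rat> \<Longrightarrow> P q" and "\<And>s. s \<in> S \<Longrightarrow> P s"
    and "\<And>x. x \<in> carrier (rat_adjoin S) \<Longrightarrow> P x \<Longrightarrow> P (- x)"
    and "\<And>x. x \<in> carrier (rat_adjoin S) \<Longrightarrow> P x \<Longrightarrow> P (inverse x)"
    and "\<And>x y. x \<in> carrier (rat_adjoin S) \<Longrightarrow> P x \<Longrightarrow> y \<in> carrier (rat_adjoin S) \<Longrightarrow> P y \<Longrightarrow> P (x + y)"
    and "\<And>x y. x \<in> carrier (rat_adjoin S) \<Longrightarrow> P x \<Longrightarrow> y \<in> carrier (rat_adjoin S) \<Longrightarrow> P y \<Longrightarrow> P (x * y)"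
  shows "P x"
proof -
  let ?C = "ring_of_type_algebra :: complex ring"
  interpret C: field ?C by (rule field_from_type_algebra)
  have C: "carrier ?C = UNIV" "\<And>x y. x \<otimes>\<^bsub>?C\<^esub> y = x * y" "\<And>x y. x \<oplus>\<^bsub>?C\<^esub> y = x + y" "\<one>\<^bsub>?C\<^esub> = 1" "\<zero>\<^bsub>?C\<^esub> = 0"
    by (simp_all add: ring_of_type_algebra_def)
  have carr: "carrier (rat_adjoin S) = generate_field ?C (\<rat> \<union> S)"
    by (simp add: rat_adjoin_def)
  have minus: "\<ominus>\<^bsub>?C\<^esub> h = - h" for h
    by (rule C.minus_equality) (simp_all add: C)
  have inv: "inv\<^bsub>?C\<^esub> h = inverse h" if "h \<noteq> 0" for h
    by (rule C.comm_inv_char) (use that in \<open>simp_all add: C\<close>)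
  show ?thesis
    using assms(1) unfolding carr
  proof (induction rule: generate_field.induct)
    case one
    then show ?case using assms(2)[of 1] by (simp add: C)
  next
    case (incl h)
    then show ?case using assms(2,3) by blast
  next
    case (a_inv h)
    then show ?case using assms(4) by (simp add: minus carr)
  next
    case (m_inv h)
    then show ?case using assms(5) by (simp add: inv carr C)
  next
    case (eng_add h1 h2)
    then show ?case using assms(6) by (simp add: carr C)
  next
    case (eng_mult h1 h2)
    then show ?case using assms(7) by (simp add: carr C)
  qed
qed

lemma rat_adjoin_least:
  assumes "algebraic_field K" "S \<subseteq> K"
  shows "carrier (rat_adjoin S) \<subseteq> K"
proof
  interpret algebraic_field K by fact
  fix x assume "x \<in> carrier (rat_adjoin S)"
  then show "x \<in> K"
    using assms(2) Rats by (induction rule: rat_adjoin_induct) (auto intro: uminus inverse add mult)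
qed

lemma finite_complex_roots:
  assumes "f \<noteq> 0" shows "finite (complex_roots f)"
  unfolding complex_roots_def using assms by (intro poly_roots_finite) simp

lemma algebraic_int_complex_roots:
  assumes "lead_coeff f = 1" "x \<in> complex_roots f" shows "algebraic_int x"
  using assms unfolding algebraic_int_altdef_ipoly complex_roots_def by blast

lemma (in embedding) hom_complex_root:
  assumes "x \<in> complex_roots f" "x \<in> K" shows "\<sigma> x \<in> complex_roots f"
proof -
  have "map_poly \<sigma> (map_poly of_int f) = map_poly of_int f"
    by (rule poly_eqI) (simp add: coeff_map_poly)
  then show ?thesis
    using hom_poly[OF poly_over_map_of_int[of f] assms(2)] assms(1) by (simp add: complex_roots_def)
qed

lemma (in embedding) hom_image_complex_roots:
  assumes "f \<noteq> 0" "complex_roots f \<subseteq> K" shows "\<sigma> ` complex_roots f = complex_roots f"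
  using finite_complex_roots[OF assms(1)] hom_complex_root assms(2) inj_on_subset[OF inj_on_hom assms(2)]
  by (intro endo_inj_surj) auto

text \<open>An embedding permutes the finitely many roots of \<open>f\<close>, so it maps the field that they generate
  onto itself.\<close>
lemma (in embedding) restrict_in_galois_group:
  assumes f: "f \<noteq> 0" and roots: "complex_roots f \<subseteq> K"
  shows "restrict \<sigma> (carrier (rat_adjoin (complex_roots f))) \<in> carrier (galois_group f)"
proof -
  let ?R = "rat_adjoin (complex_roots f)"
  let ?L = "carrier ?R"
  have LK: "?L \<subseteq> K" by (rule rat_adjoin_least[OF algebraic_field_axioms roots])
  have cl: "x + y \<in> ?L" "x * y \<in> ?L" if "x \<in> ?L" "y \<in> ?L" for x y
    using generate_field.eng_add[of x "ring_of_type_algebra" _ y]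
      generate_field.eng_mult[of x "ring_of_type_algebra" _ y] that
    by (simp_all add: rat_adjoin_def ring_of_type_algebra_def)
  have cl': "- x \<in> ?L" "inverse x \<in> ?L" if "x \<in> ?L" for x
  proof -
    interpret L: algebraic_field ?L
      using LK alg_num Rats_subset_rat_adjoin cl by unfold_locales auto
    show "- x \<in> ?L" "inverse x \<in> ?L" using L.uminus L.inverse that by auto
  qed
  have L: "\<sigma> x \<in> ?L \<and> x \<in> \<sigma> ` ?L" if "x \<in> ?L" for x
    using that
  proof (induction rule: rat_adjoin_induct)
    case (Rats q)
    then show ?case using hom_Rats[of q] Rats_subset_rat_adjoin[of "complex_roots f"] by (metis image_eqI subsetD)
  next
    case (gen s)
    then show ?case using hom_image_complex_roots[OF f roots] subset_rat_adjoin[of "complex_roots f"] by blast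
  next
    case (uminus x)
    then obtain x' where "x' \<in> ?L" "x = \<sigma> x'" by auto
    then have "- x = \<sigma> (- x')" using hom_uminus LK by auto
    then show ?case using uminus \<open>x' \<in> ?L\<close> cl'(1) hom_uminus LK by (metis image_eqI subsetD)
  next
    case (inverse x)
    then obtain x' where "x' \<in> ?L" "x = \<sigma> x'" by auto
    then have "inverse x = \<sigma> (inverse x')" using hom_inverse LK by auto
    then show ?case using inverse \<open>x' \<in> ?L\<close> cl'(2) hom_inverse LK by (metis image_eqI subsetD)
  next
    case (add x y)
    then obtain x' y' where "x' \<in> ?L" "x = \<sigma> x'" "y' \<in> ?L" "y = \<sigma> y'" by auto
    then have "x + y = \<sigma> (x' + y')" "x' + y' \<in> ?L" using hom_add[of x' y'] subsetD[OF LK] cl by auto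
    moreover have "\<sigma> (x + y) \<in> ?L"
      using hom_add[of x y] subsetD[OF LK] cl add by simp
    ultimately show ?case by blast
  next
    case (mult x y)
    then obtain x' y' where "x' \<in> ?L" "x = \<sigma> x'" "y' \<in> ?L" "y = \<sigma> y'" by auto
    then have "x * y = \<sigma> (x' * y')" "x' * y' \<in> ?L" using hom_mult[of x' y'] subsetD[OF LK] cl by auto
    moreover have "\<sigma> (x * y) \<in> ?L"
      using hom_mult[of x y] subsetD[OF LK] cl mult by simp
    ultimately show ?case by blast
  qed
  have "bij_betw \<sigma> ?L ?L"
    using L inj_on_subset[OF inj_on_hom LK] by (auto simp: bij_betw_def)
  then have bij: "bij_betw (restrict \<sigma> ?L) ?L ?L" by (simp add: bij_betw_restrict_eq)
  have "restrict \<sigma> ?L \<in> Ring.ring_hom ?R ?R"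
    using L cl LK Rats_subset_rat_adjoin[of "complex_roots f"]
    by (intro ring_hom_memI) (auto simp: rat_adjoin_simps hom_add hom_mult subset_iff)
  moreover have "restrict \<sigma> ?L \<in> Bij ?L" using bij by (simp add: Bij_def)
  moreover have "restrict \<sigma> ?L q = q" if "q \<in> \<rat>" for q
    using that hom_Rats Rats_subset_rat_adjoin[of "complex_roots f"] by auto
  ultimately show ?thesis
    using bij by (simp add: galois_group_def Gal_def ring_iso_def)
qed

lemma galois_group_embedding:
  assumes f: "lead_coeff f = 1" and \<sigma>: "\<sigma> \<in> carrier (galois_group f)"
  shows "embedding (carrier (rat_adjoin (complex_roots f))) \<sigma>"
proof -
  let ?R = "rat_adjoin (complex_roots f)"
  let ?L = "carrier ?R"
  have "f \<noteq> 0" using f by auto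
  then obtain K \<tau> where "embedding K \<tau>" "complex_roots f \<subseteq> K"
    using embedding_extends[OF finite_complex_roots algebraic_int_complex_roots[OF f] embedding_Rats]
    by metis
  then interpret K: embedding K \<tau> by simp
  have LK: "?L \<subseteq> K" by (rule rat_adjoin_least[OF K.algebraic_field_axioms]) fact
  have "\<sigma> \<in> Ring.ring_hom ?R ?R" and fix_Rats: "\<forall>q\<in>\<rat>. \<sigma> q = q"
    using \<sigma> by (auto simp: galois_group_def Gal_def ring_iso_def)
  then have "\<sigma> (x * y) = \<sigma> x * \<sigma> y" "\<sigma> (x + y) = \<sigma> x + \<sigma> y" if "x \<in> ?L" "y \<in> ?L" for x y
    using ring_hom_mult[of \<sigma> ?R ?R x y] ring_hom_add[of \<sigma> ?R ?R x y] that
    by (simp_all add: rat_adjoin_simps)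
  moreover have "x + y \<in> ?L" "x * y \<in> ?L" if "x \<in> ?L" "y \<in> ?L" for x y
    using generate_field.eng_add[of x "ring_of_type_algebra" _ y]
      generate_field.eng_mult[of x "ring_of_type_algebra" _ y] that
    by (simp_all add: rat_adjoin_def ring_of_type_algebra_def)
  ultimately show ?thesis
    using LK K.alg_num Rats_subset_rat_adjoin fix_Rats by unfold_locales auto
qed

text \<open>The permutation representation of the Galois group and its transitivity, stated for embeddings
  instead of automorphisms of the splitting field: one embedding can act on the roots of several
  polynomials at once.\<close>
definition labelling :: "nat \<Rightarrow> nat \<Rightarrow> int poly \<Rightarrow> (nat set \<Rightarrow> complex) \<Rightarrow> bool" where
  "labelling m k f a \<longleftrightarrow> bij_betw a (nsets {1..m} k) (complex_roots f) \<and>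
     (\<forall>K \<tau>. embedding K \<tau> \<longrightarrow> complex_roots f \<subseteq> K \<longrightarrow>
        (\<exists>\<pi>. \<pi> permutes {1..m} \<and> (\<forall>A\<in>nsets {1..m} k. \<tau> (a A) = a (\<pi> ` A)))) \<and>
     (\<forall>A\<in>nsets {1..m} k. \<forall>B\<in>nsets {1..m} k.
        \<exists>K \<tau>. embedding K \<tau> \<and> complex_roots f \<subseteq> K \<and> \<tau> (a A) = a B)"

lemma galois_polys_labelling:
  assumes G: "subgroup G (sym_group m)" and hom: "homogeneous m k G"
    and f: "f \<in> galois_polys H (perm_subgroup m G) (nsets {1..m} k) (subset_action m k)"
  shows "\<exists>a. labelling m k f a"
proof -
  define \<Omega> where "\<Omega> = nsets {1..m} k"
  define R where "R = complex_roots f"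
  let ?L = "carrier (rat_adjoin R)"
  have lc: "lead_coeff f = 1" using f by (auto simp: galois_polys_def monic_polys_def)
  then have f0: "f \<noteq> 0" by auto
  obtain \<phi> \<psi> where \<phi>: "\<phi> \<in> iso (galois_group f) (perm_subgroup m G)" and \<psi>: "bij_betw \<psi> R \<Omega>"
    and eq: "\<And>\<sigma> \<omega>. \<sigma> \<in> carrier (galois_group f) \<Longrightarrow> \<omega> \<in> R \<Longrightarrow>
          subset_action m k (\<phi> \<sigma>) (\<psi> \<omega>) = \<psi> (root_action f \<sigma> \<omega>)"
    using f unfolding galois_polys_def perm_group_iso_def R_def \<Omega>_def by blast
  define a where "a = inv_into R \<psi>"
  have a: "bij_betw a \<Omega> R" unfolding a_def by (rule bij_betw_inv_into[OF \<psi>])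
  have aR: "a A \<in> R" and \<psi>a: "\<psi> (a A) = A" if "A \<in> \<Omega>" for A
    using a bij_betwE that bij_betw_inv_into_right[OF \<psi>] unfolding a_def by blast+
  have a\<psi>: "a (\<psi> x) = x" if "x \<in> R" for x
    unfolding a_def using \<psi> that by (rule bij_betw_inv_into_left)
  have \<phi>G: "\<phi> \<sigma> \<in> G" if "\<sigma> \<in> carrier (galois_group f)" for \<sigma>
    using \<phi> that by (auto simp: iso_def hom_def)
  have act: "\<psi> (\<sigma> (a A)) = \<phi> \<sigma> ` A" if "\<sigma> \<in> carrier (galois_group f)" "A \<in> \<Omega>" for \<sigma> A
    using eq[OF that(1) aR[OF that(2)]] that aR[OF that(2)] \<psi>a[OF that(2)]
    by (simp add: subset_action_def root_action_def R_def \<Omega>_def)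
  have RL: "R \<subseteq> ?L" by (rule subset_rat_adjoin)
  have "\<exists>\<pi>. \<pi> permutes {1..m} \<and> (\<forall>A\<in>\<Omega>. \<tau> (a A) = a (\<pi> ` A))"
    if "embedding K \<tau>" "R \<subseteq> K" for K \<tau>
  proof -
    interpret embedding K \<tau> by fact
    let ?\<sigma> = "restrict \<tau> ?L"
    have \<sigma>: "?\<sigma> \<in> carrier (galois_group f)"
      using restrict_in_galois_group[OF f0] that(2) unfolding R_def by blast
    have "\<tau> (a A) = a (\<phi> ?\<sigma> ` A)" if A: "A \<in> \<Omega>" for A
    proof -
      have "a A \<in> ?L" using aR[OF A] RL by blast
      then have "\<psi> (\<tau> (a A)) = \<phi> ?\<sigma> ` A" using act[OF \<sigma> A] by simp
      moreover have "\<tau> (a A) \<in> R"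
        using hom_complex_root aR[OF A] \<open>R \<subseteq> K\<close> unfolding R_def by blast
      ultimately show ?thesis using a\<psi> by metis
    qed
    moreover have "\<phi> ?\<sigma> permutes {1..m}"
      using \<phi>G[OF \<sigma>] subgroup.subset[OF G] by (auto simp: sym_group_def)
    ultimately show ?thesis by blast
  qed
  moreover have "\<exists>K \<tau>. embedding K \<tau> \<and> R \<subseteq> K \<and> \<tau> (a A) = a B" if A: "A \<in> \<Omega>" and B: "B \<in> \<Omega>" for A B
  proof -
    obtain g where g: "g \<in> G" "subset_action m k g A = B"
      using transitive_action.unique_orbit[OF hom[unfolded homogeneous_def], of A B] A B
      by (auto simp: \<Omega>_def)
    have "\<phi> ` carrier (galois_group f) = G" using \<phi> by (auto simp: iso_def bij_betw_def)
    then obtain \<sigma> where \<sigma>: "\<sigma> \<in> carrier (galois_group f)" "\<phi> \<sigma> = g" using g(1) by blast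
    interpret embedding ?L \<sigma> unfolding R_def by (rule galois_group_embedding[OF lc \<sigma>(1)])
    have "\<psi> (\<sigma> (a A)) = B" using act[OF \<sigma>(1) A] g(2) \<sigma>(2) A by (simp add: subset_action_def \<Omega>_def)
    moreover have "\<sigma> (a A) \<in> R" using hom_complex_root aR[OF A] RL unfolding R_def by blast
    ultimately have "\<sigma> (a A) = a B" using a\<psi> by metis
    then show ?thesis using RL embedding_axioms by blast
  qed
  ultimately have "labelling m k f a"
    using a unfolding labelling_def \<Omega>_def R_def by blast
  then show ?thesis by blast
qed


section \<open>Integers built from labelled roots\<close>

text \<open>An irrational \<open>z\<close> would be moved by some embedding, which extends to a field that contains \<open>S\<close>.\<close>
lemma integer_if_fixed:
  assumes z: "algebraic_int z" and S: "finite S" "\<And>s. s \<in> S \<Longrightarrow> algebraic_int s"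
    and fixed: "\<And>K \<tau>. embedding K \<tau> \<Longrightarrow> S \<subseteq> K \<Longrightarrow> \<tau> z = z"
  shows "z \<in> \<int>"
proof (cases "z \<in> \<rat>")
  case True
  then show ?thesis using z by (rule rational_algebraic_int_is_int[rotated])
next
  case False
  then obtain K \<tau> where K: "embedding K \<tau>" "z \<in> K" "\<tau> z \<noteq> z"
    using embedding_moves_irrational[OF z] by blast
  obtain K' \<tau>' where "embedding K' \<tau>'" "S \<subseteq> K'" "\<forall>x\<in>K. \<tau>' x = \<tau> x"
    using embedding_extends[OF S K(1)] by blast
  with fixed K show ?thesis by metis
qed

text \<open>The numbers \<open>\<gamma>\<^sub>i\<close> of the introduction; the shift \<open>c\<close> is there to make them distinct.\<close>
definition point_product :: "nat \<Rightarrow> nat \<Rightarrow> nat \<Rightarrow> (nat set \<Rightarrow> complex) \<Rightarrow> nat \<Rightarrow> complex" where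
  "point_product m k c a i = (\<Prod>A\<in>{A \<in> nsets {1..m} k. i \<in> A}. of_nat c - a A)"

definition esym :: "nat \<Rightarrow> nat \<Rightarrow> (nat \<Rightarrow> complex) \<Rightarrow> complex" where
  "esym m j \<gamma> = (\<Sum>I\<in>nsets {1..m} j. \<Prod>i\<in>I. \<gamma> i)"

lemma bij_betw_image_nsets:
  assumes "\<pi> permutes {1..m}"
  shows "bij_betw (image \<pi>) (nsets {1..m} k) (nsets {1..m} k)"
proof (rule bij_betw_byWitness[where f' = "image (inv' \<pi>)"])
  note inv = permutes_inv[OF assms]
  show "image \<pi> ` nsets {1..m} k \<subseteq> nsets {1..m} k"
    using permutes_image_nsets[OF assms] by blast
  show "image (inv' \<pi>) ` nsets {1..m} k \<subseteq> nsets {1..m} k"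
    using permutes_image_nsets[OF inv] by blast
qed (auto simp: image_comp permutes_inv_o[OF assms])

lemma bij_betw_image_nsets_containing:
  assumes \<pi>: "\<pi> permutes {1..m}"
  shows "bij_betw (image \<pi>) {A \<in> nsets {1..m} k. i \<in> A} {A \<in> nsets {1..m} k. \<pi> i \<in> A}"
proof -
  have "bij_betw (image \<pi>) {A \<in> nsets {1..m} k. i \<in> A} (image \<pi> ` {A \<in> nsets {1..m} k. i \<in> A})"
    by (rule bij_betw_subset[OF bij_betw_image_nsets[OF \<pi>, of k]]) auto
  moreover have "image \<pi> ` {A \<in> nsets {1..m} k. i \<in> A} = {A \<in> nsets {1..m} k. \<pi> i \<in> A}"
  proof (intro equalityI subsetI)
    fix B assume B: "B \<in> {A \<in> nsets {1..m} k. \<pi> i \<in> A}"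
    then have "B \<in> image \<pi> ` nsets {1..m} k"
      using bij_betw_image_nsets[OF \<pi>, of k] by (simp add: bij_betw_def)
    then obtain A where "A \<in> nsets {1..m} k" "B = \<pi> ` A" by (rule imageE)
    then show "B \<in> image \<pi> ` {A \<in> nsets {1..m} k. i \<in> A}"
      using B permutes_inj[OF \<pi>] by (auto simp: inj_image_mem_iff)
  qed (use permutes_image_nsets[OF \<pi>] in auto)
  ultimately show ?thesis by simp
qed

context embedding
begin

text \<open>If \<open>\<sigma>\<close> acts on the indices by \<open>\<pi>\<close>, it maps the factors that belong to the sets containing \<open>i\<close> to
  those that belong to the sets containing \<open>\<pi> i\<close>.\<close>
lemma hom_point_product:
  assumes \<pi>: "\<pi> permutes {1..m}"
    and a: "\<And>A. A \<in> nsets {1..m} k \<Longrightarrow> a A \<in> K \<and> \<sigma> (a A) = a (\<pi> ` A)"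
  shows "point_product m k c a i \<in> K"
    and "\<sigma> (point_product m k c a i) = point_product m k c a (\<pi> i)"
proof -
  have c: "of_nat c \<in> K" "\<sigma> (of_nat c) = of_nat c"
    using of_int[of "int c"] hom_of_int[of "int c"] by simp_all
  then have K: "of_nat c - a A \<in> K" if "A \<in> nsets {1..m} k" for A
    using a[OF that] diff by blast
  then show "point_product m k c a i \<in> K"
    unfolding point_product_def by (intro prod) auto
  have "\<sigma> (point_product m k c a i) = (\<Prod>A\<in>{A \<in> nsets {1..m} k. i \<in> A}. of_nat c - a (\<pi> ` A))"
    unfolding point_product_def using K c a by (subst hom_prod) (auto simp: hom_diff)
  also have "\<dots> = point_product m k c a (\<pi> i)"
    unfolding point_product_def
    by (rule prod.reindex_bij_betw[OF bij_betw_image_nsets_containing[OF \<pi>]])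
  finally show "\<sigma> (point_product m k c a i) = point_product m k c a (\<pi> i)" .
qed

lemma hom_esym:
  assumes "\<pi> permutes {1..m}" and \<gamma>: "\<And>i. i \<in> {1..m} \<Longrightarrow> \<gamma> i \<in> K \<and> \<sigma> (\<gamma> i) = \<gamma> (\<pi> i)"
  shows "\<sigma> (esym m j \<gamma>) = esym m j \<gamma>"
proof -
  have I: "i \<in> {1..m}" if "I \<in> nsets {1..m} j" "i \<in> I" for i I using that by (auto simp: nsets_def)
  have P: "(\<Prod>i\<in>I. \<gamma> i) \<in> K" "\<sigma> (\<Prod>i\<in>I. \<gamma> i) = (\<Prod>i\<in>I. \<gamma> (\<pi> i))"
    if "I \<in> nsets {1..m} j" for I
  proof -
    note I = \<gamma>[OF I[OF that]]
    show "(\<Prod>i\<in>I. \<gamma> i) \<in> K" using I by (intro prod) blast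
    have "\<sigma> (\<Prod>i\<in>I. \<gamma> i) = (\<Prod>i\<in>I. \<sigma> (\<gamma> i))" using I by (intro hom_prod) blast
    also have "\<dots> = (\<Prod>i\<in>I. \<gamma> (\<pi> i))" using I by (intro prod.cong refl) blast
    finally show "\<sigma> (\<Prod>i\<in>I. \<gamma> i) = (\<Prod>i\<in>I. \<gamma> (\<pi> i))" .
  qed
  have "\<sigma> (esym m j \<gamma>) = (\<Sum>I\<in>nsets {1..m} j. \<sigma> (\<Prod>i\<in>I. \<gamma> i))"
    unfolding esym_def using P(1) by (rule hom_sum)
  also have "\<dots> = (\<Sum>I\<in>nsets {1..m} j. \<Prod>i\<in>I. \<gamma> (\<pi> i))"
    using P(2) by (intro sum.cong refl)
  also have "\<dots> = (\<Sum>I\<in>nsets {1..m} j. \<Prod>i\<in>\<pi> ` I. \<gamma> i)"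
    using permutes_inj_on[OF assms(1)] by (simp add: prod.reindex)
  also have "\<dots> = esym m j \<gamma>"
    unfolding esym_def by (rule sum.reindex_bij_betw[OF bij_betw_image_nsets[OF assms(1)]])
  finally show ?thesis .
qed

end

lemma labellingD:
  assumes "labelling m k f a"
  shows "bij_betw a (nsets {1..m} k) (complex_roots f)"
    and "embedding K \<tau> \<Longrightarrow> complex_roots f \<subseteq> K \<Longrightarrow>
      \<exists>\<pi>. \<pi> permutes {1..m} \<and> (\<forall>A\<in>nsets {1..m} k. \<tau> (a A) = a (\<pi> ` A))"
    and "A \<in> nsets {1..m} k \<Longrightarrow> B \<in> nsets {1..m} k \<Longrightarrow>
      \<exists>K \<tau>. embedding K \<tau> \<and> complex_roots f \<subseteq> K \<and> \<tau> (a A) = a B"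
  using assms unfolding labelling_def by blast+

lemma labelling_root: "labelling m k f a \<Longrightarrow> A \<in> nsets {1..m} k \<Longrightarrow> a A \<in> complex_roots f"
  using labellingD(1) bij_betwE by blast

lemma algebraic_int_point_product:
  assumes "lead_coeff f = 1" "labelling m k f a"
  shows "algebraic_int (point_product m k c a i)"
  unfolding point_product_def
proof (rule algebraic_int_prod)
  fix A assume "A \<in> {A \<in> nsets {1..m} k. i \<in> A}"
  then have "algebraic_int (- a A)"
    using algebraic_int_complex_roots[OF assms(1) labelling_root[OF assms(2)]] by auto
  from algebraic_int_add[OF _ this, of "of_nat c"] show "algebraic_int (of_nat c - a A)" by simp
qed

lemma esym_point_product_in_Ints:
  assumes lc: "lead_coeff f = 1" and lab: "labelling m k f a"
  shows "esym m j (point_product m k c a) \<in> \<int>"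
proof (rule integer_if_fixed)
  show "algebraic_int (esym m j (point_product m k c a))"
    unfolding esym_def by (intro algebraic_int_sum algebraic_int_prod algebraic_int_point_product[OF lc lab])
  show "finite (complex_roots f)" using lc by (intro finite_complex_roots) auto
  show "\<And>s. s \<in> complex_roots f \<Longrightarrow> algebraic_int s" using algebraic_int_complex_roots[OF lc] .
  fix K \<tau> assume K: "embedding K \<tau>" "complex_roots f \<subseteq> K"
  interpret embedding K \<tau> by fact
  obtain \<pi> where \<pi>: "\<pi> permutes {1..m}" "\<And>A. A \<in> nsets {1..m} k \<Longrightarrow> \<tau> (a A) = a (\<pi> ` A)"
    using labellingD(2)[OF lab K] by blast
  show "\<tau> (esym m j (point_product m k c a)) = esym m j (point_product m k c a)"
    using \<pi> hom_point_product[OF \<pi>(1), of k a c] labelling_root[OF lab] K(2)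
    by (intro hom_esym[OF \<pi>(1)]) blast
qed

text \<open>The crucial point is that the two labellings are compatible. An embedding \<open>\<tau>\<close> induces permutations
  \<open>\<pi>\<close> and \<open>\<pi>'\<close> of the points, one for each polynomial. Both describe the action of \<open>\<tau>\<close> on the common
  point products, and as these are distinct, \<open>\<pi> = \<pi>'\<close>. Hence \<open>\<tau>\<close> merely permutes the factors of
  the product of differences. If one factor vanishes, conjugating it shows that all of them do.\<close>
lemma difference_product_in_Ints:
  assumes lc: "lead_coeff f = 1" "lead_coeff f' = 1"
    and lab: "labelling m k f a" "labelling m k f' a'"
    and eq: "\<And>i. i \<in> {1..m} \<Longrightarrow> point_product m k c a i = point_product m k c a' i"
    and inj: "inj_on (point_product m k c a) {1..m}"
  shows "(\<Prod>A\<in>nsets {1..m} k. a A - a' A) \<in> \<int>"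
    and "(\<Prod>A\<in>nsets {1..m} k. a A - a' A) = 0 \<Longrightarrow> complex_roots f = complex_roots f'"
proof -
  let ?\<Omega> = "nsets {1..m} k" and ?S = "complex_roots f \<union> complex_roots f'"
  have S: "finite ?S" "\<And>s. s \<in> ?S \<Longrightarrow> algebraic_int s"
  proof -
    have "f \<noteq> 0" "f' \<noteq> 0" using lc by (metis leading_coeff_0_iff zero_neq_one)+
    then show "finite ?S" by (simp add: finite_complex_roots)
    show "algebraic_int s" if "s \<in> ?S" for s
      using that algebraic_int_complex_roots[OF lc(1)] algebraic_int_complex_roots[OF lc(2)] by blast
  qed
  have same: "\<exists>\<pi>. \<pi> permutes {1..m} \<and> (\<forall>A\<in>?\<Omega>. \<tau> (a A) = a (\<pi> ` A) \<and> \<tau> (a' A) = a' (\<pi> ` A))"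
    if K: "embedding K \<tau>" "?S \<subseteq> K" for K \<tau>
  proof -
    interpret embedding K \<tau> by fact
    obtain \<pi> where \<pi>: "\<pi> permutes {1..m}" "\<And>A. A \<in> ?\<Omega> \<Longrightarrow> \<tau> (a A) = a (\<pi> ` A)"
      using labellingD(2)[OF lab(1) K(1)] K(2) by blast
    obtain \<pi>' where \<pi>': "\<pi>' permutes {1..m}" "\<And>A. A \<in> ?\<Omega> \<Longrightarrow> \<tau> (a' A) = a' (\<pi>' ` A)"
      using labellingD(2)[OF lab(2) K(1)] K(2) by blast
    have "\<pi> i = \<pi>' i" if i: "i \<in> {1..m}" for i
    proof -
      have m: "\<pi> i \<in> {1..m}" "\<pi>' i \<in> {1..m}" using i permutes_in_image[OF \<pi>(1)] permutes_in_image[OF \<pi>'(1)] by blast+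
      have "point_product m k c a (\<pi> i) = \<tau> (point_product m k c a i)"
        using \<pi>(2) labelling_root[OF lab(1)] K(2)
        by (intro hom_point_product(2)[OF \<pi>(1), symmetric]) blast
      also have "\<dots> = \<tau> (point_product m k c a' i)" using eq[OF i] by simp
      also have "\<dots> = point_product m k c a' (\<pi>' i)"
        using \<pi>'(2) labelling_root[OF lab(2)] K(2)
        by (intro hom_point_product(2)[OF \<pi>'(1)]) blast
      also have "\<dots> = point_product m k c a (\<pi>' i)" using eq[OF m(2)] by simp
      finally show ?thesis using inj m by (meson inj_onD)
    qed
    then have "\<pi> ` A = \<pi>' ` A" if "A \<in> ?\<Omega>" for A
      using that by (intro image_cong) (auto simp: nsets_def)
    then show ?thesis using \<pi> \<pi>' by metis
  qed
  show "(\<Prod>A\<in>?\<Omega>. a A - a' A) \<in> \<int>"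
  proof (rule integer_if_fixed[OF _ S])
    show "algebraic_int (\<Prod>A\<in>?\<Omega>. a A - a' A)"
    proof (rule algebraic_int_prod)
      fix A assume A: "A \<in> ?\<Omega>"
      then have "algebraic_int (- a' A)" "algebraic_int (a A)"
        using algebraic_int_complex_roots lc labelling_root lab by auto
      from algebraic_int_add[OF this(2,1)] show "algebraic_int (a A - a' A)" by simp
    qed
    fix K \<tau> assume K: "embedding K \<tau>" "?S \<subseteq> K"
    interpret embedding K \<tau> by fact
    obtain \<pi> where \<pi>: "\<pi> permutes {1..m}"
      "\<And>A. A \<in> ?\<Omega> \<Longrightarrow> \<tau> (a A) = a (\<pi> ` A) \<and> \<tau> (a' A) = a' (\<pi> ` A)"
      using same[OF K] by blast
    have "a A \<in> K" "a' A \<in> K" if "A \<in> ?\<Omega>" for A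
      using labelling_root[OF lab(1) that] labelling_root[OF lab(2) that] K(2) by auto
    then have "\<tau> (\<Prod>A\<in>?\<Omega>. a A - a' A) = (\<Prod>A\<in>?\<Omega>. a (\<pi> ` A) - a' (\<pi> ` A))"
      using \<pi>(2) by (subst hom_prod) (auto simp: hom_diff diff)
    also have "\<dots> = (\<Prod>A\<in>?\<Omega>. a A - a' A)"
      by (rule prod.reindex_bij_betw[OF bij_betw_image_nsets[OF \<pi>(1)], where g = "\<lambda>A. a A - a' A"])
    finally show "\<tau> (\<Prod>A\<in>?\<Omega>. a A - a' A) = (\<Prod>A\<in>?\<Omega>. a A - a' A)" .
  qed
  assume "(\<Prod>A\<in>?\<Omega>. a A - a' A) = 0"
  then obtain A where A: "A \<in> ?\<Omega>" "a A = a' A" by (auto simp: prod_zero_iff finite_imp_finite_nsets)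
  have "a B = a' B" if B: "B \<in> ?\<Omega>" for B
  proof -
    obtain K \<tau> where K: "embedding K \<tau>" "complex_roots f \<subseteq> K" "\<tau> (a A) = a B"
      using labellingD(3)[OF lab(1) A(1) B] by blast
    then obtain K' \<tau>' where K': "embedding K' \<tau>'" "?S \<subseteq> K'" "\<And>x. x \<in> K \<Longrightarrow> \<tau>' x = \<tau> x"
      using embedding_extends[OF S K(1)] by blast
    obtain \<pi> where \<pi>: "\<pi> permutes {1..m}"
      "\<And>A. A \<in> ?\<Omega> \<Longrightarrow> \<tau>' (a A) = a (\<pi> ` A) \<and> \<tau>' (a' A) = a' (\<pi> ` A)"
      using same[OF K'(1,2)] by blast
    have "\<tau>' (a A) = a B" using K K'(3) labelling_root[OF lab(1) A(1)] by auto
    then have aB: "a (\<pi> ` A) = a B" "a B = a' (\<pi> ` A)" using \<pi>(2)[OF A(1)] A(2) by auto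
    then have "\<pi> ` A = B"
      using labellingD(1)[OF lab(1)] permutes_image_nsets[OF \<pi>(1) A(1)] B
      by (meson bij_betw_def inj_onD)
    then show ?thesis using aB by simp
  qed
  then have "a ` ?\<Omega> = a' ` ?\<Omega>" by (intro image_cong) auto
  then show "complex_roots f = complex_roots f'"
    using labellingD(1)[OF lab(1)] labellingD(1)[OF lab(2)] by (simp add: bij_betw_def)
qed


section \<open>Point products and their elementary symmetric functions\<close>

lemma nsets_containing:
  assumes "finite S" "i \<in> S" "j \<in> S" "i \<noteq> j" "1 \<le> k" "k < card S"
  obtains A where "A \<in> nsets S k" "i \<in> A" "j \<notin> A"
proof -
  have "card (S - {i, j}) = card S - 2" using assms by (subst card_Diff_subset) auto
  then have "k - 1 \<le> card (S - {i, j})" using assms by linarith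
  then obtain B where B: "B \<subseteq> S - {i, j}" "card B = k - 1" "finite B"
    by (metis obtain_subset_with_card_n)
  then have "insert i B \<in> nsets S k" using assms by (auto simp: nsets_def card_insert_if)
  moreover have "j \<notin> insert i B" using B assms by auto
  ultimately show ?thesis using that by blast
qed

text \<open>As polynomials in \<open>c\<close>, the point products of \<open>i \<noteq> j\<close> differ: a set \<open>A\<close> that contains \<open>i\<close> but not \<open>j\<close>
  gives a root \<open>a A\<close> of only one of them. So the product of all their differences is a nonzero
  polynomial, and its degree bounds the number of unsuitable \<open>c\<close>.\<close>
lemma exists_separating_shift:
  fixes a :: "nat set \<Rightarrow> complex"
  assumes inj: "inj_on a (nsets {1..m} k)" and k: "1 \<le> k" "k < m"
  obtains c where "c \<le> m * m * card (nsets {1..m} k)" "inj_on (point_product m k c a) {1..m}"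
proof -
  let ?\<Omega> = "nsets {1..m} k"
  have fin: "finite ?\<Omega>" by (simp add: finite_imp_finite_nsets)
  define P where "P i = (\<Prod>A\<in>{A \<in> ?\<Omega>. i \<in> A}. [:- a A, 1:])" for i
  have poly_P: "poly (P i) (of_nat c) = point_product m k c a i" for i c
    by (simp add: P_def point_product_def poly_prod)
  define I where "I = {(i, j). i \<in> {1..m} \<and> j \<in> {1..m} \<and> i \<noteq> j}"
  have I: "I \<subseteq> {1..m} \<times> {1..m}" by (auto simp: I_def)
  then have finI: "finite I" and cardI: "card I \<le> m * m"
    using finite_subset[OF I] card_mono[OF _ I] by auto
  define Q where "Q = (\<Prod>(i, j)\<in>I. P i - P j)"
  have "P i - P j \<noteq> 0" if "(i, j) \<in> I" for i j
  proof -
    have "i \<in> {1..m}" "j \<in> {1..m}" "i \<noteq> j" using that by (auto simp: I_def)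
    then obtain A where A: "A \<in> ?\<Omega>" "i \<in> A" "j \<notin> A"
      using nsets_containing[of "{1..m}" i j k] k by (metis card_atLeastAtMost diff_Suc_1 finite_atLeastAtMost)
    have "poly (P i) (a A) = 0" using A fin by (auto simp: P_def poly_prod prod_zero_iff)
    moreover have "poly (P j) (a A) \<noteq> 0"
      using A inj fin by (auto simp: P_def poly_prod prod_zero_iff dest: inj_onD)
    ultimately show ?thesis by auto
  qed
  then have "Q \<noteq> 0" using finI by (auto simp: Q_def prod_zero_iff)
  have deg_P: "degree (P i) \<le> card ?\<Omega>" for i
  proof -
    have "degree (P i) \<le> card {A \<in> ?\<Omega>. i \<in> A}"
      using degree_prod_sum_le[of "{A \<in> ?\<Omega>. i \<in> A}" "\<lambda>A. [:- a A, 1:]"] fin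
      by (simp add: P_def o_def)
    also have "\<dots> \<le> card ?\<Omega>" using fin by (intro card_mono) auto
    finally show ?thesis .
  qed
  have "degree Q \<le> (\<Sum>x\<in>I. degree (P (fst x) - P (snd x)))"
    unfolding Q_def case_prod_beta using degree_prod_sum_le[OF finI, of "\<lambda>x. P (fst x) - P (snd x)"] by (simp add: o_def)
  also have "\<dots> \<le> (\<Sum>x\<in>I. card ?\<Omega>)" by (intro sum_mono degree_diff_le deg_P)
  also have "\<dots> \<le> m * m * card ?\<Omega>" using cardI by simp
  finally have degQ: "degree Q \<le> m * m * card ?\<Omega>" .
  have "\<exists>c \<le> m * m * card ?\<Omega>. poly Q (of_nat c) \<noteq> 0"
  proof (rule ccontr)
    assume "\<not> ?thesis"
    then have "of_nat ` {..m * m * card ?\<Omega>} \<subseteq> {x. poly Q x = 0}" by auto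
    then have "card (of_nat ` {..m * m * card ?\<Omega>} :: complex set) \<le> card {x. poly Q x = 0}"
      using poly_roots_finite[OF \<open>Q \<noteq> 0\<close>] by (rule card_mono[rotated])
    also have "\<dots> \<le> degree Q" using \<open>Q \<noteq> 0\<close> by (rule card_poly_roots_bound)
    finally show False using degQ by (simp add: card_image inj_on_def)
  qed
  then obtain c where c: "c \<le> m * m * card ?\<Omega>" "poly Q (of_nat c) \<noteq> 0" by blast
  have "inj_on (point_product m k c a) {1..m}"
  proof (rule inj_onI, rule ccontr)
    fix i j assume *: "i \<in> {1..m}" "j \<in> {1..m}" "point_product m k c a i = point_product m k c a j" "i \<noteq> j"
    then have "(i, j) \<in> I" "poly (P i - P j) (of_nat c) = 0" by (auto simp: I_def poly_P)
    then have "poly Q (of_nat c) = 0" using finI by (auto simp: Q_def poly_prod prod_zero_iff intro!: bexI[of _ "(i, j)"])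
    with c(2) show False by simp
  qed
  with c(1) show ?thesis by (rule that)
qed

text \<open>The elementary symmetric functions are the coefficients of the product of all \<open>\<gamma> i + y\<close>, a
  polynomial in \<open>y\<close> with roots \<open>- \<gamma> i\<close>.\<close>
lemma esym_determines_values:
  assumes eq: "\<And>j. j \<in> {1..m} \<Longrightarrow> esym m j \<gamma> = esym m j \<gamma>'" and i: "i \<in> {1..m}"
  shows "\<gamma>' i \<in> \<gamma> ` {1..m}"
proof -
  have expand: "(\<Prod>i\<in>{1..m}. \<delta> i + y) = (\<Sum>j\<le>m. esym m j \<delta> * y ^ (m - j))" for \<delta> and y :: complex
  proof -
    have "(\<Prod>i\<in>{1..m}. \<delta> i + y) = (\<Sum>I\<in>Pow {1..m}. (\<Prod>i\<in>I. \<delta> i) * y ^ (m - card I))"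
      by (subst prod_add) (auto intro!: sum.cong simp: card_Diff_subset finite_subset)
    also have "\<dots> = (\<Sum>j\<le>m. \<Sum>I | I \<in> Pow {1..m} \<and> card I = j. (\<Prod>i\<in>I. \<delta> i) * y ^ (m - card I))"
      using card_mono[of "{1..m}"] by (intro sum.group[symmetric]) auto
    also have "\<dots> = (\<Sum>j\<le>m. esym m j \<delta> * y ^ (m - j))"
      unfolding esym_def sum_distrib_right
      by (intro sum.cong refl) (auto simp: nsets_def finite_subset intro: finite_subset)
    finally show ?thesis .
  qed
  have "esym m j \<gamma> = esym m j \<gamma>'" if "j \<le> m" for j
  proof (cases "j = 0")
    case True
    have "nsets {1..m} 0 = {{}}" by (auto simp: nsets_def)
    then show ?thesis by (simp add: True esym_def del: One_nat_def)
  qed (use eq that in simp)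
  then have same: "(\<Prod>i\<in>{1..m}. \<gamma> i + y) = (\<Prod>i\<in>{1..m}. \<gamma>' i + y)" for y
    unfolding expand by simp
  have "(\<Prod>l\<in>{1..m}. \<gamma>' l + - \<gamma>' i) = 0" using i by (intro prod_zero) auto
  then have "(\<Prod>l\<in>{1..m}. \<gamma> l + - \<gamma>' i) = 0" unfolding same .
  then obtain l where "l \<in> {1..m}" "\<gamma> l + - \<gamma>' i = 0" by (auto simp: prod_zero_iff)
  then show ?thesis by (intro image_eqI[of _ _ l]) auto
qed

text \<open>Each \<open>A\<close> contains exactly \<open>k\<close> points.\<close>
lemma prod_nsets_containing:
  fixes g :: "nat set \<Rightarrow> 'a :: comm_semiring_1"
  shows "(\<Prod>i\<in>{1..m}. \<Prod>A\<in>{A \<in> nsets {1..m} k. i \<in> A}. g A) = (\<Prod>A\<in>nsets {1..m} k. g A) ^ k"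
proof -
  have "(\<Prod>i\<in>{1..m}. \<Prod>A\<in>{A \<in> nsets {1..m} k. i \<in> A}. g A)
      = (\<Prod>A\<in>nsets {1..m} k. \<Prod>i\<in>{i \<in> {1..m}. i \<in> A}. g A)"
    by (rule prod.swap_restrict) (auto simp: finite_imp_finite_nsets)
  also have "\<dots> = (\<Prod>A\<in>nsets {1..m} k. g A ^ k)"
  proof (intro prod.cong refl)
    fix A assume "A \<in> nsets {1..m} k"
    then have "{i \<in> {1..m}. i \<in> A} = A" "card A = k" by (auto simp: nsets_def)
    then show "(\<Prod>i\<in>{i \<in> {1..m}. i \<in> A}. g A) = g A ^ k" by simp
  qed
  also have "\<dots> = (\<Prod>A\<in>nsets {1..m} k. g A) ^ k" by (rule prod_power_distrib[symmetric])
  finally show ?thesis .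
qed

lemma esym_top_point_product:
  "esym m m (point_product m k c a) = (\<Prod>A\<in>nsets {1..m} k. of_nat c - a A) ^ k"
proof -
  have "I = {1..m}" if "I \<in> nsets {1..m} m" for I
    using that card_subset_eq[of "{1..m}" I] by (simp add: nsets_def)
  moreover have "{1..m} \<in> nsets {1..m} m" by (simp add: nsets_def)
  ultimately have "nsets {1..m} m = {{1..m}}" by blast
  then show ?thesis by (simp add: esym_def point_product_def prod_nsets_containing del: One_nat_def)
qed

lemma norm_shift_le: "cmod (of_nat c - z) \<le> (1 + real c) * max 1 (cmod z)"
proof -
  have "cmod (of_nat c - z) \<le> real c + cmod z" using norm_triangle_ineq4[of "of_nat c" z] by simp
  also have "\<dots> \<le> real c * max 1 (cmod z) + max 1 (cmod z)" by (intro add_mono) (auto simp: mult_le_cancel_left1)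
  finally show ?thesis by (simp add: algebra_simps)
qed

lemma norm_prod_shift_le:
  "cmod (\<Prod>A\<in>\<Omega>. of_nat c - a A) \<le> (1 + real c) ^ card \<Omega> * (\<Prod>A\<in>\<Omega>. max 1 (cmod (a A)))"
proof -
  have "cmod (\<Prod>A\<in>\<Omega>. of_nat c - a A) \<le> (\<Prod>A\<in>\<Omega>. (1 + real c) * max 1 (cmod (a A)))"
    unfolding prod_norm[symmetric] by (intro prod_mono) (auto simp: norm_shift_le)
  then show ?thesis by (simp add: prod.distrib)
qed

text \<open>A product of point products over a set of points contains each root factor at most \<open>k\<close> times, so it
  is at most the \<open>k\<close>-th power of the product of \<^emph>\<open>all\<close> root factors, each enlarged to be at least 1.
  This is why the exponent of the height does not grow with \<open>j\<close>.\<close>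
lemma norm_esym_point_product_le:
  "cmod (esym m j (point_product m k c a))
    \<le> 2 ^ m * ((1 + real c) ^ card (nsets {1..m} k) * (\<Prod>A\<in>nsets {1..m} k. max 1 (cmod (a A)))) ^ k"
proof -
  let ?\<Omega> = "nsets {1..m} k"
  let ?y = "\<lambda>A. (1 + real c) * max 1 (cmod (a A))"
  have fin: "finite ?\<Omega>" by (simp add: finite_imp_finite_nsets)
  have y1: "1 \<le> ?y A" for A
    using mult_mono[of 1 "1 + real c" 1 "max 1 (cmod (a A))"] by simp
  have "cmod (\<Prod>i\<in>I. point_product m k c a i) \<le> (\<Prod>A\<in>?\<Omega>. ?y A) ^ k" if "I \<in> nsets {1..m} j" for I
  proof -
    have y: "1 \<le> (\<Prod>A\<in>{A \<in> ?\<Omega>. i \<in> A}. ?y A)" for i by (intro prod_ge_1 y1)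
    have "cmod (\<Prod>i\<in>I. point_product m k c a i) \<le> (\<Prod>i\<in>I. \<Prod>A\<in>{A \<in> ?\<Omega>. i \<in> A}. ?y A)"
      unfolding point_product_def prod_norm[symmetric]
      by (intro prod_mono conjI prod_nonneg norm_ge_zero norm_shift_le)
    also have "\<dots> \<le> (\<Prod>i\<in>{1..m}. \<Prod>A\<in>{A \<in> ?\<Omega>. i \<in> A}. ?y A)"
      using that y by (intro prod_mono2) (auto simp: nsets_def intro: order_trans[OF zero_le_one])
    also have "\<dots> = (\<Prod>A\<in>?\<Omega>. ?y A) ^ k" by (rule prod_nsets_containing)
    finally show ?thesis .
  qed
  then have "cmod (esym m j (point_product m k c a)) \<le> (\<Sum>I\<in>nsets {1..m} j. (\<Prod>A\<in>?\<Omega>. ?y A) ^ k)"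
    unfolding esym_def by (rule sum_norm_le)
  also have "\<dots> = real (card (nsets {1..m} j)) * (\<Prod>A\<in>?\<Omega>. ?y A) ^ k" by simp
  also have "\<dots> \<le> 2 ^ m * (\<Prod>A\<in>?\<Omega>. ?y A) ^ k"
  proof (intro mult_right_mono zero_le_power prod_nonneg)
    have "card (nsets {1..m} j) \<le> card (Pow {1..m})" by (intro card_mono) (auto simp: nsets_def)
    then have "card (nsets {1..m} j) \<le> 2 ^ m" by (simp add: card_Pow)
    from of_nat_mono[OF this, where 'a = real] show "real (card (nsets {1..m} j)) \<le> 2 ^ m" by simp
  qed auto
  finally show ?thesis by (simp add: prod.distrib)
qed


section \<open>Root sizes and separated families\<close>

lemma monic_separable_eq_prod:
  assumes "lead_coeff f = 1" "Defs.separable f"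
  shows "(map_poly of_int f :: complex poly) = (\<Prod>z\<in>complex_roots f. [:- z, 1:])"
  using complex_poly_decompose_rsquarefree[of "map_poly of_int f"] assms
  by (simp add: Defs.separable_def complex_roots_def)

lemma monic_separable_eqI:
  assumes "lead_coeff f = 1" "Defs.separable f" "lead_coeff f' = 1" "Defs.separable f'"
    and "complex_roots f = complex_roots f'"
  shows "f = f'"
proof -
  have "(map_poly of_int f :: complex poly) = map_poly of_int f'"
    unfolding monic_separable_eq_prod[OF assms(1,2)] monic_separable_eq_prod[OF assms(3,4)] assms(5)
    by (rule refl)
  then have "of_int (coeff f i) = (of_int (coeff f' i) :: complex)" for i
    by (metis coeff_map_poly of_int_0)
  then show ?thesis by (intro poly_eqI) simp
qed

lemma labelling_prod_shift:
  assumes "lead_coeff f = 1" "Defs.separable f" "labelling m k f a"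
  shows "(\<Prod>A\<in>nsets {1..m} k. of_nat c - a A) = of_int (poly f (int c))"
proof -
  have "(\<Prod>A\<in>nsets {1..m} k. of_nat c - a A) = (\<Prod>z\<in>complex_roots f. of_nat c - z)"
    by (rule prod.reindex_bij_betw[OF labellingD(1)[OF assms(3)]])
  also have "\<dots> = poly (map_poly of_int f) (of_int (int c))"
    unfolding monic_separable_eq_prod[OF assms(1,2)] by (simp add: poly_prod)
  also have "\<dots> = of_int (poly f (int c))" by (rule of_int_hom.poly_map_poly)
  finally show ?thesis .
qed

text \<open>Landau's inequality bounds the Mahler measure by the Euclidean norm of the coefficient vector.\<close>
lemma Mahler_measure_le_height:
  assumes f: "f \<in> monic_polys n H" "Defs.separable f" and H: "1 \<le> H"
  shows "(\<Prod>z\<in>complex_roots f. max 1 (cmod z)) \<le> real (n + 1) * H"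
proof -
  let ?f = "map_poly of_int f :: complex poly"
  have lc: "lead_coeff f = 1" and deg: "degree f = n" and ht: "real_of_int (Defs.height f) \<le> H"
    using f by (auto simp: monic_polys_def)
  then have "f \<noteq> 0" by auto
  then obtain xs where xs: "set xs = complex_roots f" "distinct xs"
    using finite_distinct_list[OF finite_complex_roots] by blast
  have "?f = smult 1 (\<Prod>x\<leftarrow>xs. [:- x, 1:])"
    using monic_separable_eq_prod[OF lc f(2)] prod.distinct_set_conv_list[OF xs(2), of "\<lambda>z. [:- z, 1:]"]
    by (simp add: xs(1))
  then have "mahler_measure_poly ?f = cmod 1 * (\<Prod>x\<leftarrow>xs. max 1 (cmod x))"
    by (simp only: mahler_measure_poly_explicit)
  also have "\<dots> = (\<Prod>z\<in>complex_roots f. max 1 (cmod z))"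
    using prod.distinct_set_conv_list[OF xs(2), of "\<lambda>z. max 1 (cmod z)"] by (simp add: xs(1))
  finally have "(\<Prod>z\<in>complex_roots f. max 1 (cmod z)) \<le> sqrt (\<Sum>c\<leftarrow>coeffs ?f. (cmod c)\<^sup>2)"
    using Landau_inequality[of ?f] by simp
  also have "\<dots> \<le> real (n + 1) * H"
  proof (rule real_le_lsqrt)
    have "?f \<noteq> 0" using \<open>f \<noteq> 0\<close> by simp
    have c: "(cmod (coeff ?f i))\<^sup>2 \<le> H\<^sup>2" if "i \<le> n" for i
    proof -
      have "\<bar>coeff f i\<bar> \<le> Defs.height f"
        unfolding Defs.height_def using that deg by (intro Max_ge) auto
      then have "\<bar>real_of_int (coeff f i)\<bar> \<le> H" using ht by linarith
      then show ?thesis by (intro power_mono) (simp_all add: coeff_map_poly)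
    qed
    have "(\<Sum>c\<leftarrow>coeffs ?f. (cmod c)\<^sup>2) = (\<Sum>i\<le>n. (cmod (coeff ?f i))\<^sup>2)"
      using \<open>?f \<noteq> 0\<close> deg
      by (simp add: coeffs_def interv_sum_list_conv_sum_set_nat o_def atLeast0LessThan lessThan_Suc_atMost del: upt_Suc)
    also have "\<dots> \<le> (\<Sum>i\<le>n. H\<^sup>2)" using c by (intro sum_mono) auto
    also have "\<dots> = real (n + 1) * H\<^sup>2" by simp
    also have "\<dots> \<le> (real (n + 1) * H)\<^sup>2"
      unfolding power_mult_distrib by (intro mult_right_mono) (simp_all add: power2_eq_square)
    finally show "(\<Sum>c\<leftarrow>coeffs ?f. (cmod c)\<^sup>2) \<le> (real (n + 1) * H)\<^sup>2" .
  qed (use H in simp)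
  finally show ?thesis .
qed

lemma bounded_ints:
  fixes B :: real
  assumes "0 \<le> B"
  shows "finite {z::int. \<bar>real_of_int z\<bar> \<le> B}" "real (card {z::int. \<bar>real_of_int z\<bar> \<le> B}) \<le> 2 * B + 1"
proof -
  have eq: "{z::int. \<bar>real_of_int z\<bar> \<le> B} = {- \<lfloor>B\<rfloor>..\<lfloor>B\<rfloor>}"
    by (auto simp: abs_le_iff le_floor_iff minus_le_iff)
  show "finite {z::int. \<bar>real_of_int z\<bar> \<le> B}" unfolding eq by simp
  have "0 \<le> \<lfloor>B\<rfloor>" using assms by simp
  then show "real (card {z::int. \<bar>real_of_int z\<bar> \<le> B}) \<le> 2 * B + 1"
    unfolding eq by simp
qed

lemma card_le_fibres:
  fixes b :: real
  assumes "finite T" "key ` F \<subseteq> T" "finite F"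
    and "\<And>t. t \<in> T \<Longrightarrow> real (card {f \<in> F. key f = t}) \<le> b"
  shows "real (card F) \<le> real (card T) * b"
proof -
  have "card F = (\<Sum>t\<in>T. card {f \<in> F. key f = t})"
    using sum_fun_comp[of F T key "\<lambda>_. 1::nat"] assms(1-3) by simp
  then have "real (card F) = (\<Sum>t\<in>T. real (card {f \<in> F. key f = t}))" by simp
  also have "\<dots> \<le> (\<Sum>t\<in>T. b)" by (intro sum_mono assms(4))
  finally show ?thesis by simp
qed

text \<open>A pigeonhole argument. Sort the vectors by the dyadic sizes \<open>2\<^sup>e\<close> of their coordinates. Within one
  class, divide the square of side about \<open>2\<^sup>e\<close> that contains a coordinate into little squares whose
  side is smaller by the factor \<open>T\<close>, which is of the size of the \<open>n\<close>-th root of \<open>P\<close>, with \<open>n = card I\<close>, and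
  is the same for all coordinates and classes. If two vectors share all their little squares, the product of their
  coordinate differences is at most \<open>2\<^sup>n P / T\<^sup>n < 1\<close>. There are about \<open>T\<^sup>2\<close> little squares for each
  coordinate, hence about \<open>P\<^sup>2\<close> boxes in a class, and a power of \<open>log P\<close> many classes.\<close>
lemma separated_family_card_le:
  fixes v :: "'f \<Rightarrow> 'i \<Rightarrow> complex"
  assumes F: "finite F" and I: "finite I" "I \<noteq> {}" and P: "1 \<le> P"
    and M: "\<And>f. f \<in> F \<Longrightarrow> (\<Prod>i\<in>I. max 1 (cmod (v f i))) \<le> P"
    and sep: "\<And>f g. f \<in> F \<Longrightarrow> g \<in> F \<Longrightarrow> f \<noteq> g \<Longrightarrow> 1 \<le> cmod (\<Prod>i\<in>I. v f i - v g i)"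
  shows "real (card F) \<le> 441 ^ card I * (log 2 P + 1) ^ card I * P\<^sup>2"
proof -
  define n where "n = card I"
  have n: "0 < n" using I by (simp add: n_def card_gt_0_iff)
  \<comment> \<open>The factor 3 outweighs the factor 2 lost for each coordinate in comparing a side of a square with its diameter.\<close>
  define T where "T = 3 * root n P"
  have r1: "1 \<le> root n P" using n P by simp
  then have T1: "1 \<le> T" by (simp add: T_def)
  have Tn: "T ^ n = 3 ^ n * P" using n P by (simp add: T_def power_mult_distrib)
  define x where "x f i = max 1 (cmod (v f i))" for f i
  define e where "e f i = nat \<lfloor>log 2 (x f i)\<rfloor>" for f i
  have x1: "1 \<le> x f i" for f i by (simp add: x_def)
  have e: "2 ^ e f i \<le> x f i" "x f i < 2 * 2 ^ e f i" for f i
  proof -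
    have l0: "0 \<le> log 2 (x f i)" using x1[of f i] by simp
    then have fl: "real (e f i) = of_int \<lfloor>log 2 (x f i)\<rfloor>" by (simp add: e_def)
    have "2 powr real (e f i) \<le> 2 powr log 2 (x f i)" unfolding fl by (intro powr_mono) auto
    then show "2 ^ e f i \<le> x f i" using x1[of f i] by (simp add: powr_realpow)
    have "2 powr log 2 (x f i) < 2 powr (real (e f i) + 1)" unfolding fl by (intro powr_less_mono) linarith+
    then show "x f i < 2 * 2 ^ e f i" using x1[of f i] by (simp add: powr_realpow powr_add)
  qed
  define s where "s f i = 2 ^ e f i / T" for f i
  have s0: "0 < s f i" for f i using T1 by (simp add: s_def)
  define key where "key f = (\<lambda>i\<in>I. (e f i, \<lfloor>Re (v f i) / s f i\<rfloor>, \<lfloor>Im (v f i) / s f i\<rfloor>))" for f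
  define Z where "Z = {z::int. \<bar>real_of_int z\<bar> \<le> 2 * T + 1}"
  define E where "E = {..nat \<lfloor>log 2 P\<rfloor>}"
  have floor_Z: "\<lfloor>y / s f i\<rfloor> \<in> Z" if "\<bar>y\<bar> \<le> cmod (v f i)" for y f i
  proof -
    have "\<bar>y\<bar> \<le> x f i" using that by (simp add: x_def)
    also have "\<dots> \<le> 2 * T * s f i" using e(2)[of f i] T1 by (simp add: s_def)
    finally have "\<bar>y / s f i\<bar> \<le> 2 * T" using s0[of f i] by (simp add: abs_divide divide_le_eq)
    then show ?thesis unfolding Z_def mem_Collect_eq by linarith
  qed
  have e_E: "e f i \<in> E" if "f \<in> F" "i \<in> I" for f i
  proof -
    have "x f i = (\<Prod>j\<in>{i}. x f j)" by simp
    also have "\<dots> \<le> (\<Prod>j\<in>I. x f j)"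
      using I that x1 by (intro prod_mono2) (auto intro: order_trans[OF zero_le_one])
    also have "\<dots> \<le> P" using M[OF that(1)] by (simp add: x_def)
    finally have "log 2 (x f i) \<le> log 2 P" using x1[of f i] by simp
    then show ?thesis unfolding E_def e_def by (simp add: nat_mono floor_mono)
  qed
  have "key ` F \<subseteq> (\<Pi>\<^sub>E i\<in>I. E \<times> Z \<times> Z)"
    using e_E floor_Z abs_Re_le_cmod abs_Im_le_cmod by (auto simp: key_def)
  moreover have fin: "finite E" "finite Z" using T1 bounded_ints(1) by (auto simp: E_def Z_def)
  ultimately have "card (key ` F) \<le> card (\<Pi>\<^sub>E i\<in>I. E \<times> Z \<times> Z)"
    using I(1) by (intro card_mono finite_PiE) auto
  also have "\<dots> = (card E * (card Z * card Z)) ^ n"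
    using I(1) by (simp add: card_PiE card_cartesian_product n_def)
  finally have "real (card (key ` F)) \<le> (real (card E) * (real (card Z) * real (card Z))) ^ n"
    using of_nat_mono[where 'a = real] by fastforce
  also have "\<dots> \<le> ((log 2 P + 1) * (7 * T * (7 * T))) ^ n"
  proof -
    have "real (card Z) \<le> 2 * (2 * T + 1) + 1" unfolding Z_def using T1 by (intro bounded_ints) simp
    also have "\<dots> \<le> 7 * T" using T1 by simp
    finally have "real (card Z) \<le> 7 * T" .
    moreover have "real (card E) \<le> log 2 P + 1" using P by (simp add: E_def)
    ultimately show ?thesis using T1 P by (intro power_mono mult_mono) auto
  qed
  also have "\<dots> = 49 ^ n * (log 2 P + 1) ^ n * (T ^ n)\<^sup>2"
    by (simp add: power_mult_distrib power2_eq_square flip: power_mult_distrib) (simp add: algebra_simps)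
  also have "\<dots> = 441 ^ n * (log 2 P + 1) ^ n * P\<^sup>2"
  proof -
    have "(49::real) ^ n * (3 ^ n)\<^sup>2 = 441 ^ n"
      by (simp add: power2_eq_square flip: power_mult_distrib)
    then show ?thesis unfolding Tn power_mult_distrib by (simp add: mult_ac)
  qed
  finally have "real (card (key ` F)) \<le> 441 ^ n * (log 2 P + 1) ^ n * P\<^sup>2" .
  moreover have "inj_on key F"
  proof (rule inj_onI, rule ccontr)
    fix f g assume fg: "f \<in> F" "g \<in> F" "key f = key g" "f \<noteq> g"
    have "cmod (v f i - v g i) \<le> 2 * s f i" if "i \<in> I" for i
    proof -
      have k: "e f i = e g i" "\<lfloor>Re (v f i) / s f i\<rfloor> = \<lfloor>Re (v g i) / s g i\<rfloor>"
          "\<lfloor>Im (v f i) / s f i\<rfloor> = \<lfloor>Im (v g i) / s g i\<rfloor>"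
        using fun_cong[OF fg(3), of i] that by (auto simp: key_def)
      then have sg: "s g i = s f i" by (simp add: s_def)
      have close: "\<bar>y - y'\<bar> \<le> s f i" if "\<lfloor>y / s f i\<rfloor> = \<lfloor>y' / s f i\<rfloor>" for y y'
      proof -
        have "\<bar>y / s f i - y' / s f i\<bar> \<le> 1" using that by linarith
        then show ?thesis using s0[of f i] by (simp add: diff_divide_distrib[symmetric] abs_divide divide_le_eq)
      qed
      have "cmod (v f i - v g i) \<le> \<bar>Re (v f i - v g i)\<bar> + \<bar>Im (v f i - v g i)\<bar>" by (rule cmod_le)
      also have "\<dots> \<le> s f i + s f i" using k close unfolding sg by (intro add_mono) auto
      finally show ?thesis by simp
    qed
    then have "cmod (\<Prod>i\<in>I. v f i - v g i) \<le> (\<Prod>i\<in>I. 2 * s f i)"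
      unfolding prod_norm[symmetric] by (intro prod_mono) auto
    also have "\<dots> = 2 ^ n * (\<Prod>i\<in>I. 2 ^ e f i) / T ^ n"
      by (simp add: s_def prod.distrib prod_dividef n_def)
    also have "\<dots> \<le> 2 ^ n * P / T ^ n"
    proof (intro divide_right_mono mult_left_mono)
      have "(\<Prod>i\<in>I. 2 ^ e f i) \<le> (\<Prod>i\<in>I. x f i)" by (intro prod_mono) (simp add: e)
      also have "\<dots> \<le> P" using M[OF fg(1)] by (simp add: x_def)
      finally show "(\<Prod>i\<in>I. 2 ^ e f i) \<le> P" .
    qed (use T1 in auto)
    also have "2 ^ n * P / T ^ n = (2 / 3) ^ n" using P by (simp add: Tn power_divide)
    also have "(2 / 3 :: real) ^ n < 1" using n by (simp add: power_less_one_iff)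
    finally show False using sep[OF fg(1,2,4)] by simp
  qed
  then have "card (key ` F) = card F" by (rule card_image)
  ultimately show ?thesis by (simp add: n_def)
qed


section \<open>Counting\<close>

lemma log_power_le_powr:
  fixes n :: nat and \<epsilon> :: real
  assumes "\<epsilon> > 0" "n > 0"
  obtains C where "C > 0" "\<And>P. 1 \<le> P \<Longrightarrow> (log 2 P + 1) ^ n \<le> C * P powr \<epsilon>"
proof -
  define \<delta> where "\<delta> = \<epsilon> / n"
  have \<delta>: "\<delta> > 0" "\<delta> * n = \<epsilon>" using assms by (auto simp: \<delta>_def)
  \<comment> \<open>The summand 1 absorbs the 1 in \<open>log 2 P + 1\<close>.\<close>
  define D where "D = 1 / (\<delta> * ln 2) + 1"
  have D: "D > 0" using \<delta> by (auto simp: D_def intro!: add_pos_pos divide_pos_pos mult_pos_pos)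
  show ?thesis
  proof (rule that[of "D ^ n"])
    show "D ^ n > 0" using D by simp
    fix P :: real assume P: "1 \<le> P"
    have "ln P \<le> P powr \<delta> / \<delta>" by (rule ln_powr_bound[OF P \<delta>(1)])
    then have "log 2 P \<le> P powr \<delta> / \<delta> / ln 2" unfolding log_def by (intro divide_right_mono) auto
    moreover have "1 \<le> P powr \<delta>" using P \<delta> by (simp add: ge_one_powr_ge_zero)
    ultimately have "log 2 P + 1 \<le> D * P powr \<delta>" by (simp add: D_def algebra_simps)
    then have "(log 2 P + 1) ^ n \<le> (D * P powr \<delta>) ^ n" using P by (intro power_mono) auto
    also have "\<dots> = D ^ n * P powr \<epsilon>"
      using P \<delta>(2) by (simp add: power_mult_distrib powr_power mult.commute)
    finally show "(log 2 P + 1) ^ n \<le> D ^ n * P powr \<epsilon>" .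
  qed
qed

lemma card_monic_polys_le:
  assumes "1 \<le> H" shows "real (card (monic_polys n H)) \<le> (3 * H) ^ n"
proof -
  let ?Z = "{z::int. \<bar>real_of_int z\<bar> \<le> H}"
  let ?key = "\<lambda>f :: int poly. restrict (coeff f) {..<n}"
  have Z: "finite ?Z" "real (card ?Z) \<le> 3 * H" using bounded_ints[of H] assms by auto
  have "?key ` monic_polys n H \<subseteq> {..<n} \<rightarrow>\<^sub>E ?Z"
  proof (intro subsetI, elim imageE)
    fix g f assume g: "g = ?key f" and f: "f \<in> monic_polys n H"
    have ht: "real_of_int (Defs.height f) \<le> H" using f by (simp add: monic_polys_def)
    have "\<bar>real_of_int (coeff f i)\<bar> \<le> H" if "i < n" for i
    proof -
      have "\<bar>coeff f i\<bar> \<le> Defs.height f"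
        unfolding Defs.height_def using that f by (intro Max_ge) (auto simp: monic_polys_def)
      then show ?thesis using ht by linarith
    qed
    then show "g \<in> {..<n} \<rightarrow>\<^sub>E ?Z" unfolding g by auto
  qed
  then have "card (?key ` monic_polys n H) \<le> card ({..<n} \<rightarrow>\<^sub>E ?Z)"
    using Z(1) by (intro card_mono finite_PiE) auto
  also have "\<dots> = card ?Z ^ n" by (simp add: card_PiE)
  finally have le: "card (?key ` monic_polys n H) \<le> card ?Z ^ n" .
  have "inj_on ?key (monic_polys n H)"
  proof (rule inj_onI)
    fix f g assume fg: "f \<in> monic_polys n H" "g \<in> monic_polys n H" "?key f = ?key g"
    show "f = g"
    proof (rule poly_eqI)
      fix i
      consider "i < n" | "i = n" | "i > n" by linarith
      then show "coeff f i = coeff g i"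
      proof cases
        case 1
        then show ?thesis using fun_cong[OF fg(3), of i] by simp
      qed (use fg(1,2) in \<open>auto simp: monic_polys_def coeff_eq_0\<close>)
    qed
  qed
  then have "real (card (monic_polys n H)) = real (card (?key ` monic_polys n H))"
    by (simp add: card_image)
  also have "\<dots> \<le> real (card ?Z ^ n)" using le by (simp only: of_nat_le_iff)
  also have "\<dots> \<le> (3 * H) ^ n" using power_mono[OF Z(2), of n] by simp
  finally show ?thesis .
qed

lemma galois_polys_invariants:
  assumes G: "subgroup G (sym_group m)" "homogeneous m k G" and k: "1 \<le> k" "k < m" and H: "1 \<le> H"
    and f: "f \<in> galois_polys H (perm_subgroup m G) (nsets {1..m} k) (subset_action m k)"
    and n: "n = card (nsets {1..m} k)" and N: "N = m * m * n" and D: "D = (1 + real N) ^ n * real (n + 1)"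
  shows "\<exists>a c w e. labelling m k f a \<and> c \<le> N \<and> inj_on (point_product m k c a) {1..m} \<and>
    (\<Prod>A\<in>nsets {1..m} k. max 1 (cmod (a A))) \<le> real (n + 1) * H \<and>
    of_int w = (\<Prod>A\<in>nsets {1..m} k. of_nat c - a A) \<and> \<bar>real_of_int w\<bar> \<le> D * H \<and>
    (\<forall>j. of_int (e j) = esym m j (point_product m k c a) \<and> \<bar>real_of_int (e j)\<bar> \<le> 2 ^ m * (D * H) ^ k)"
proof -
  let ?\<Omega> = "nsets {1..m} k"
  have mon: "f \<in> monic_polys n H" and sep: "Defs.separable f" using f by (auto simp: galois_polys_def n)
  then have lc: "lead_coeff f = 1" by (auto simp: monic_polys_def)
  obtain a where lab: "labelling m k f a" using galois_polys_labelling[OF G f] by blast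
  note bij = labellingD(1)[OF lab]
  obtain c where c: "c \<le> N" "inj_on (point_product m k c a) {1..m}"
    using exists_separating_shift[of a m k] bij k unfolding N n bij_betw_def by metis
  let ?M = "\<Prod>A\<in>?\<Omega>. max 1 (cmod (a A))"
  have M: "?M \<le> real (n + 1) * H"
    using Mahler_measure_le_height[OF mon sep H] prod.reindex_bij_betw[OF bij, of "\<lambda>z. max 1 (cmod z)"]
    by simp
  have B: "(1 + real c) ^ card ?\<Omega> * ?M \<le> D * H"
  proof -
    have "(1 + real c) ^ card ?\<Omega> * ?M \<le> (1 + real N) ^ n * (real (n + 1) * H)"
      unfolding n[symmetric] using c(1) M by (intro mult_mono power_mono prod_nonneg) auto
    then show ?thesis by (simp add: D mult.assoc)
  qed
  have M0: "0 \<le> (1 + real c) ^ card ?\<Omega> * ?M" by (intro mult_nonneg_nonneg prod_nonneg) auto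
  define w where "w = poly f (int c)"
  have w: "of_int w = (\<Prod>A\<in>?\<Omega>. of_nat c - a A)"
    unfolding w_def using labelling_prod_shift[OF lc sep lab] by simp
  have w_le: "\<bar>real_of_int w\<bar> \<le> D * H"
  proof -
    have "\<bar>real_of_int w\<bar> = cmod (of_int w)" by simp
    also have "\<dots> \<le> (1 + real c) ^ card ?\<Omega> * ?M" unfolding w by (rule norm_prod_shift_le)
    finally show ?thesis using B by linarith
  qed
  have "\<forall>j. \<exists>e. of_int e = esym m j (point_product m k c a)"
    using esym_point_product_in_Ints[OF lc lab] by (metis Ints_cases)
  then obtain e :: "nat \<Rightarrow> int" where e: "\<And>j. of_int (e j) = esym m j (point_product m k c a)" by metis
  have e_le: "\<bar>real_of_int (e j)\<bar> \<le> 2 ^ m * (D * H) ^ k" for j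
  proof -
    have "\<bar>real_of_int (e j)\<bar> = cmod (of_int (e j))" by simp
    also have "\<dots> \<le> 2 ^ m * ((1 + real c) ^ card ?\<Omega> * ?M) ^ k"
      unfolding e by (rule norm_esym_point_product_le)
    also have "\<dots> \<le> 2 ^ m * (D * H) ^ k" using B M0 by (intro mult_left_mono power_mono) auto
    finally show ?thesis .
  qed
  show ?thesis
    by (intro exI[of _ a] exI[of _ c] exI[of _ w] exI[of _ e] conjI allI lab c M w w_le e e_le)
qed

text \<open>The product of the differences of corresponding roots is a nonzero integer, so the vectors of
  labelled roots are separated in the sense of \<open>separated_family_card_le\<close>.\<close>
lemma card_common_point_products_le:
  assumes F: "finite F" and n: "n = card (nsets {1..m} k)" "0 < n" and P: "1 \<le> P"
    and mon: "\<And>f. f \<in> F \<Longrightarrow> lead_coeff f = 1" and sep: "\<And>f. f \<in> F \<Longrightarrow> Defs.separable f"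
    and lab: "\<And>f. f \<in> F \<Longrightarrow> labelling m k f (a f)"
    and M: "\<And>f. f \<in> F \<Longrightarrow> (\<Prod>A\<in>nsets {1..m} k. max 1 (cmod (a f A))) \<le> P"
    and inj: "\<And>f. f \<in> F \<Longrightarrow> inj_on (point_product m k c (a f)) {1..m}"
    and same: "\<And>f i. f \<in> F \<Longrightarrow> i \<in> {1..m} \<Longrightarrow> point_product m k c (a f) i = \<gamma> i"
  shows "real (card F) \<le> 441 ^ n * (log 2 P + 1) ^ n * P\<^sup>2"
  unfolding n(1)
proof (rule separated_family_card_le[OF F _ _ P M])
  show "finite (nsets {1..m} k)" by (simp add: finite_imp_finite_nsets)
  show "nsets {1..m} k \<noteq> {}" using n by (metis card.empty less_irrefl)
  fix f g assume fg: "f \<in> F" "g \<in> F" "f \<noteq> g"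
  let ?z = "\<Prod>A\<in>nsets {1..m} k. a f A - a g A"
  have eq: "point_product m k c (a f) i = point_product m k c (a g) i" if "i \<in> {1..m}" for i
    using same fg that by simp
  note D = difference_product_in_Ints[OF mon mon lab lab eq inj, OF fg(1,2,1,2) _ fg(1)]
  have "?z \<noteq> 0" using D(2) monic_separable_eqI[OF mon sep mon sep] fg by blast
  moreover obtain z :: int where "?z = of_int z" using D(1) by (auto elim: Ints_cases)
  ultimately show "1 \<le> cmod ?z" by simp
qed

text \<open>The factors count, in this order: the shift \<open>c\<close>; the value \<open>w = f(c)\<close>; the elementary symmetric
  functions of the point products of index \<open>1, \<dots>, m - 1\<close> (the last one is \<open>w\<^sup>k\<close>); the assignments of
  the point products to the points, once their set is known; and the polynomials with given \<open>c\<close> and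
  given point products.\<close>
theorem card_galois_polys_le:
  assumes G: "subgroup G (sym_group m)" "homogeneous m k G" and k: "1 \<le> k" "k < m" and H: "1 \<le> H"
    and n: "n = card (nsets {1..m} k)" and N: "N = m * m * n" and D: "D = (1 + real N) ^ n * real (n + 1)"
    and P: "P = real (n + 1) * H"
  shows "real (card (galois_polys H (perm_subgroup m G) (nsets {1..m} k) (subset_action m k)))
    \<le> real (N + 1) * (3 * D * H) * (3 * 2 ^ m * (D * H) ^ k) ^ (m - 1) * real m ^ m
        * (441 ^ n * (log 2 P + 1) ^ n * P\<^sup>2)"
proof -
  define F where "F = galois_polys H (perm_subgroup m G) (nsets {1..m} k) (subset_action m k)"
  have finF: "finite F" unfolding F_def by (rule finite_galois_polys)
  have n0: "0 < n"
    using k nsets_eq_empty_iff[of "{1..m}" k] by (auto simp: n card_gt_0_iff finite_imp_finite_nsets)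
  have DH: "1 \<le> D * H"
  proof -
    have "1 \<le> (1 + real N) ^ n" "1 \<le> real (n + 1)" by simp_all
    then have "1 * 1 \<le> D" unfolding D by (intro mult_mono) auto
    then have "1 * 1 \<le> D * H" using H by (intro mult_mono) auto
    then show ?thesis by simp
  qed
  have P1: "1 \<le> P" unfolding P using H mult_mono[of 1 "real (n + 1)" 1 H] by simp
  define b where "b = 441 ^ n * (log 2 P + 1) ^ n * P\<^sup>2"
  have b0: "0 \<le> b" unfolding b_def using P1 by (intro mult_nonneg_nonneg) auto
  have "\<forall>f\<in>F. \<exists>a c w e. labelling m k f a \<and> c \<le> N \<and> inj_on (point_product m k c a) {1..m} \<and>
    (\<Prod>A\<in>nsets {1..m} k. max 1 (cmod (a A))) \<le> P \<and>
    of_int w = (\<Prod>A\<in>nsets {1..m} k. of_nat c - a A) \<and> \<bar>real_of_int w\<bar> \<le> D * H \<and>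
    (\<forall>j. of_int (e j) = esym m j (point_product m k c a) \<and> \<bar>real_of_int (e j)\<bar> \<le> 2 ^ m * (D * H) ^ k)"
    unfolding F_def P by (intro ballI galois_polys_invariants[OF G k H _ n N D])
  then obtain a :: "int poly \<Rightarrow> nat set \<Rightarrow> complex" and c :: "int poly \<Rightarrow> nat"
    and w :: "int poly \<Rightarrow> int" and e :: "int poly \<Rightarrow> nat \<Rightarrow> int"
    where inv: "\<forall>f\<in>F. labelling m k f (a f) \<and> c f \<le> N \<and> inj_on (point_product m k (c f) (a f)) {1..m} \<and>
    (\<Prod>A\<in>nsets {1..m} k. max 1 (cmod (a f A))) \<le> P \<and>
    of_int (w f) = (\<Prod>A\<in>nsets {1..m} k. of_nat (c f) - a f A) \<and> \<bar>real_of_int (w f)\<bar> \<le> D * H \<and>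
    (\<forall>j. of_int (e f j) = esym m j (point_product m k (c f) (a f)) \<and>
        \<bar>real_of_int (e f j)\<bar> \<le> 2 ^ m * (D * H) ^ k)"
    by metis
  have mon: "lead_coeff f = 1" "Defs.separable f" if "f \<in> F" for f
    using that by (auto simp: F_def galois_polys_def monic_polys_def)
  define \<gamma> where "\<gamma> f = point_product m k (c f) (a f)" for f
  \<comment> \<open>The last elementary symmetric function is left out because it is determined by \<open>w f\<close>.\<close>
  define key where "key f = (c f, w f, restrict (e f) {1..<m})" for f
  define Z where "Z B = {z::int. \<bar>real_of_int z\<bar> \<le> B}" for B
  define T where "T = {..N} \<times> Z (D * H) \<times> ({1..<m} \<rightarrow>\<^sub>E Z (2 ^ m * (D * H) ^ k))"
  have Z: "finite (Z B)" "real (card (Z B)) \<le> 3 * B" if "1 \<le> B" for B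
    using bounded_ints[of B] that unfolding Z_def by auto
  have B2: "1 \<le> 2 ^ m * (D * H) ^ k"
    using mult_mono[of 1 "2 ^ m" 1 "(D * H) ^ k"] DH by (simp add: one_le_power)
  have finT: "finite T" unfolding T_def using Z(1) DH B2 by (intro finite_cartesian_product finite_PiE) auto
  have keyT: "key ` F \<subseteq> T" using inv by (auto simp: key_def T_def Z_def)
  have cardT: "real (card T) \<le> real (N + 1) * (3 * D * H) * (3 * 2 ^ m * (D * H) ^ k) ^ (m - 1)"
  proof -
    have "card T = (N + 1) * (card (Z (D * H)) * card (Z (2 ^ m * (D * H) ^ k)) ^ (m - 1))"
      by (simp add: T_def card_cartesian_product card_PiE)
    then have "real (card T)
        = real (N + 1) * (real (card (Z (D * H))) * real (card (Z (2 ^ m * (D * H) ^ k))) ^ (m - 1))"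
      by (simp only: of_nat_mult semiring_1_class.of_nat_power)
    also have "\<dots> \<le> real (N + 1) * ((3 * (D * H)) * (3 * (2 ^ m * (D * H) ^ k)) ^ (m - 1))"
      using Z(2)[OF DH] Z(2)[OF B2] DH B2 by (intro mult_left_mono mult_mono power_mono) auto
    finally show ?thesis by (simp only: mult.assoc)
  qed
  have fibre: "real (card {f \<in> F. key f = t}) \<le> real m ^ m * b" for t
  proof (cases "{f \<in> F. key f = t} = {}")
    case True
    then show ?thesis using b0 by (simp only: card.empty) simp
  next
    case False
    then obtain f0 where f0: "f0 \<in> F" "key f0 = t" by blast
    let ?F = "{f \<in> F. key f = t}"
    let ?S = "\<gamma> f0 ` {1..m}"
    let ?val = "\<lambda>f. restrict (\<gamma> f) {1..m}"
    have "\<gamma> f i \<in> ?S" if f: "f \<in> ?F" and i: "i \<in> {1..m}" for f i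
    proof (rule esym_determines_values[OF _ i])
      fix j assume j: "j \<in> {1..m}"
      have same: "c f = c f0" "w f = w f0" "restrict (e f) {1..<m} = restrict (e f0) {1..<m}"
        using f f0 by (auto simp: key_def)
      show "esym m j (\<gamma> f0) = esym m j (\<gamma> f)"
      proof (cases "j = m")
        case True
        have "esym m m (\<gamma> g) = of_int (w g) ^ k" if "g \<in> F" for g
          using inv that by (simp add: \<gamma>_def esym_top_point_product)
        then show ?thesis using True same(2) f f0 by simp
      next
        case False
        have "e f j = e f0 j" using fun_cong[OF same(3), of j] j False by auto
        moreover have "esym m j (\<gamma> g) = of_int (e g j)" if "g \<in> F" for g
          using inv that by (simp add: \<gamma>_def)
        ultimately show ?thesis using f f0 by simp
      qed
    qed
    then have "?val ` ?F \<subseteq> {1..m} \<rightarrow>\<^sub>E ?S" by auto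
    moreover have "finite ({1..m} \<rightarrow>\<^sub>E ?S)" by (intro finite_PiE) auto
    ultimately have "real (card ?F) \<le> real (card ({1..m} \<rightarrow>\<^sub>E ?S)) * b"
    proof (intro card_le_fibres)
      fix g
      show "real (card {f \<in> ?F. ?val f = g}) \<le> b"
        unfolding b_def
      proof (rule card_common_point_products_le[OF _ n n0 P1, where c = "fst t" and a = a and \<gamma> = g])
        fix f assume f: "f \<in> {f \<in> ?F. ?val f = g}"
        then have "c f = fst t" by (auto simp: key_def)
        then show "inj_on (point_product m k (fst t) (a f)) {1..m}"
          using inv f by auto
        show "point_product m k (fst t) (a f) i = g i" if "i \<in> {1..m}" for i
          using f that \<open>c f = fst t\<close> by (auto simp: \<gamma>_def)
      qed (use finF inv mon in auto)
    qed (use finF in auto)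
    also have "\<dots> \<le> real m ^ m * b"
    proof (intro mult_right_mono b0)
      have "card ?S \<le> m" using card_image_le[of "{1..m}" "\<gamma> f0"] by simp
      then have "card ({1..m} \<rightarrow>\<^sub>E ?S) \<le> m ^ m" by (simp add: card_PiE power_mono del: One_nat_def)
      from of_nat_mono[OF this, where 'a = real] show "real (card ({1..m} \<rightarrow>\<^sub>E ?S)) \<le> real m ^ m" by simp
    qed
    finally show ?thesis .
  qed
  have "real (card F) \<le> real (card T) * (real m ^ m * b)"
    by (rule card_le_fibres[OF finT keyT finF fibre])
  also have "\<dots> \<le> real (N + 1) * (3 * D * H) * (3 * 2 ^ m * (D * H) ^ k) ^ (m - 1) * (real m ^ m * b)"
    using cardT b0 by (intro mult_right_mono) auto
  finally show ?thesis by (simp add: F_def b_def mult.assoc)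
qed

text \<open>For \<open>k = 1\<close> the trivial count of all monic polynomials of degree \<open>m\<close> suffices. For \<open>k \<ge> 2\<close> the
  previous bound is \<open>O(H\<^bsup>k(m-1)+3\<^esup>)\<close> up to a power of \<open>log H\<close>, and \<open>k (m - 1) + 3 \<le> m k + 1\<close>.\<close>
theorem theorem1p2:
  fixes \<epsilon> :: real and m k :: nat and G :: "(nat \<Rightarrow> nat) set"
  assumes "\<epsilon> > 0"
    and "1 \<le> k" and "real k \<le> real m / 2"
    and "subgroup G (sym_group m)"
    and "homogeneous m k G"
  shows "\<exists>C>0. \<forall>H\<ge>1.
    real (card (galois_polys H (perm_subgroup m G) (nsets {1..m} k) (subset_action m k)))
      \<le> C * H powr (real (m * k) + 1 + \<epsilon>)"
proof (cases "k = 1")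
  case True
  have n: "card (nsets {1..m} k) = m" unfolding True by (simp add: card_nsets)
  have "real (card (galois_polys H (perm_subgroup m G) (nsets {1..m} k) (subset_action m k)))
      \<le> 3 ^ m * H powr (real (m * k) + 1 + \<epsilon>)" if H: "1 \<le> H" for H
  proof -
    have "card (galois_polys H (perm_subgroup m G) (nsets {1..m} k) (subset_action m k)) \<le> card (monic_polys m H)"
      using n by (intro card_mono finite_monic_polys) (auto simp: galois_polys_def)
    then have "real (card (galois_polys H (perm_subgroup m G) (nsets {1..m} k) (subset_action m k))) \<le> (3 * H) ^ m"
      using card_monic_polys_le[OF H, of m] by linarith
    also have "\<dots> = 3 ^ m * H powr real m" using H by (simp add: power_mult_distrib powr_realpow)
    also have "\<dots> \<le> 3 ^ m * H powr (real (m * k) + 1 + \<epsilon>)"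
      using H \<open>\<epsilon> > 0\<close> True by (intro mult_left_mono powr_mono) auto
    finally show ?thesis .
  qed
  then show ?thesis by (intro exI[of _ "3 ^ m"]) simp
next
  case False
  then have k: "1 \<le> k" "k < m" "2 \<le> k" using assms(2,3) by auto
  define n where "n = card (nsets {1..m} k)"
  define N where "N = m * m * n"
  define D where "D = (1 + real N) ^ n * real (n + 1)"
  have n0: "0 < n"
    using k nsets_eq_empty_iff[of "{1..m}" k] by (auto simp: n_def card_gt_0_iff finite_imp_finite_nsets)
  have D: "D > 0" unfolding D_def by simp
  obtain L where L: "L > 0" "\<And>P. 1 \<le> P \<Longrightarrow> (log 2 P + 1) ^ n \<le> L * P powr \<epsilon>"
    using log_power_le_powr[OF \<open>\<epsilon> > 0\<close> n0] by blast
  define C where "C = real (N + 1) * (3 * D) * (3 * 2 ^ m * D ^ k) ^ (m - 1) * real m ^ m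
      * (441 ^ n * L * real (n + 1) powr \<epsilon> * (real (n + 1))\<^sup>2)"
  have "real (card (galois_polys H (perm_subgroup m G) (nsets {1..m} k) (subset_action m k)))
      \<le> C * H powr (real (m * k) + 1 + \<epsilon>)" if H: "1 \<le> H" for H
  proof -
    define P where "P = real (n + 1) * H"
    have P1: "1 \<le> P" unfolding P_def using H mult_mono[of 1 "real (n + 1)" 1 H] by simp
    let ?A = "real (N + 1) * (3 * D * H) * (3 * 2 ^ m * (D * H) ^ k) ^ (m - 1) * real m ^ m"
    have A0: "0 \<le> ?A" using D H by (intro mult_nonneg_nonneg zero_le_power) auto
    have "real (card (galois_polys H (perm_subgroup m G) (nsets {1..m} k) (subset_action m k)))
        \<le> ?A * (441 ^ n * (log 2 P + 1) ^ n * P\<^sup>2)"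
      by (rule card_galois_polys_le[OF assms(4,5) k(1,2) H n_def N_def D_def P_def])
    also have "\<dots> \<le> ?A * (441 ^ n * (L * P powr \<epsilon>) * P\<^sup>2)"
      using L(2)[OF P1] A0 by (intro mult_left_mono mult_right_mono) auto
    also have "\<dots> = C * (H * (H ^ k) ^ (m - 1) * H powr \<epsilon> * H\<^sup>2)"
      using H by (simp add: C_def P_def powr_mult power_mult_distrib mult_ac)
    also have "H * (H ^ k) ^ (m - 1) * H powr \<epsilon> * H\<^sup>2 = H powr (real (k * (m - 1) + 3) + \<epsilon>)"
    proof -
      have "H * (H ^ k) ^ (m - 1) * H\<^sup>2 = H ^ (k * (m - 1) + 3)"
        by (simp add: power_add power_mult power2_eq_square power3_eq_cube mult_ac)
      also have "\<dots> = H powr real (k * (m - 1) + 3)" by (rule powr_realpow[symmetric]) (use H in simp)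
      finally show ?thesis by (simp add: powr_add mult_ac)
    qed
    also have "C * H powr (real (k * (m - 1) + 3) + \<epsilon>) \<le> C * H powr (real (m * k) + 1 + \<epsilon>)"
    proof (intro mult_left_mono powr_mono)
      have "k * (m - 1) + k = m * k" using k by (cases m) auto
      then have "k * (m - 1) + 3 \<le> m * k + 1" using k(3) by linarith
      then show "real (k * (m - 1) + 3) + \<epsilon> \<le> real (m * k) + 1 + \<epsilon>"
        by (metis add_right_mono of_nat_1 of_nat_add of_nat_le_iff)
      show "0 \<le> C" unfolding C_def using D L(1) by (intro mult_nonneg_nonneg zero_le_power) auto
    qed (use H in auto)
    finally show ?thesis .
  qed
  moreover have "C > 0" unfolding C_def using D L(1) k n0 by (intro mult_pos_pos zero_less_power) auto
  ultimately show ?thesis by blast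
qed

end
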